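(* Let $C$ be a finitely aligned higher rank graph with a finite number of identities which has no sources and is row finite. Then the following are equivalent: (1) $C$ is aperiodic and cofinal. (2) The Boolean inverse monoid $\mathsf{B}(C)$ is simple.
   Context: Categories. $\mathbb{N}=\{0,1,2,\dots\}$. A category $C$ is regarded as a set of arrows, with the set of identities $C_o\subseteq C$; each arrow $a$ has a domain $\mathbf{d}(a)\in C_o$ and codomain $\mathbf{r}(a)\in C_o$, and $ab$ is defined exactly when $\mathbf{d}(a)=\mathbf{r}(b)$. Put $aC=\{ac : ac \text{ defined}\}$ and $XC=\bigcup_{x\in X}xC$. $C$ is finitely aligned if for all $a,b\in C$ there is a finite (possibly empty) set $X$ with $aC\cap bC=XC$. Elements $a,b$ are independent if $aC\cap bC=\varnothing$, otherwise dependent. A subset $X\subseteq aC$ is large in $aC$ if every $b\in aC$ is dependent on some element of $X$. Higher rank graphs. A $k$-graph ($k\ge 1$) is a countable category $C$ with a functor $d\colon C\to\mathbb{N}^k$ (the degree) such that whenever $d(a)=\mathbf{m}+\mathbf{n}$ there are unique $a_1,a_2\in C$ with $a=a_1a_2$, $d(a_1)=\mathbf{m}$, $d(a_2)=\mathbf{n}$. A higher rank graph is a $k$-graph for some $k$. It has no sources if for each $e\in C_o$ and $\mathbf{m}\in\mathbb{N}^k$ there is $x\in C$ with $\mathbf{r}(x)=e$, $d(x)=\mathbf{m}$; it is row finite if for each $e\in C_o$ and $\mathbf{m}\in\mathbb{N}^k$ the set of $x\in eC$ with $d(x)=\mathbf{m}$ is finite. $C$ is aperiodic if for all $a\neq b$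 in $C$ with $\mathbf{d}(a)=\mathbf{d}(b)$ there is $u\in C$ (with $au,bu$ defined) such that $au$ and $bu$ are independent. $C$ is cofinal if for all $e,f\in C_o$ there is a finite large subset $X$ of $fC$ such that for every $x\in X$ there is an arrow $a$ with $\mathbf{r}(a)=e$ and $\mathbf{d}(a)=\mathbf{d}(x)$. The monoid $\mathsf{B}(C)$. A right ideal of $C$ is a (possibly empty) subset $R$ with $RC\subseteq R$; it is finitely generated if $R=XC$ with $X$ finite. A bijective morphism $\theta\colon R_1\to R_2$ of right ideals is a bijection with $\mathbf{d}(\theta(r))=\mathbf{d}(r)$ and $\theta(rc)=\theta(r)c$ whenever $rc$ is defined. $\mathsf{R}(C)$ is the inverse monoid of all bijective morphisms between finitely generated right ideals of $C$, under composition of partial bijections; its zero is the empty function. On an inverse semigroup with zero, $a\le b\Leftrightarrow a=ba^{-1}a$, and the Lenz congruence is: $s\equiv t$ iff for each $0<x\le s$ there is a non-zero element below both $x$ and $t$, and for each $0<y\le t$ there is a non-zero element below both $y$ and $s$. Put $\mathsf{B}(C)=\mathsf{R}(C)/{\equiv}$; under the hypotheses it is a Boolean inverse monoid (every compatible pair $a,b$, i.e. $a^{-1}b$ and $ab^{-1}$ idempotent, has a join, multiplication distributes over such joins, and the idempotents form a Boolean algebra). Simplicity. An inverse semigroup is fundamental if the only elements commuting with all idempotents are idempotents. An additive ideal of a Boolean inverse monoid is a semigroup ideal $I$ such that $a,b\in I$ compatible implies $a\vee b\in I$. A Boolean inverse monoid $S$ is $0$-simplifying if its only additive ideals are $\{0\}$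 and $S$; it is simple if it is fundamental and $0$-simplifying. *)

theory Defs
  imports
    "HOL-Algebra.Group"
    "HOL-Analysis.Finite_Cartesian_Product"
    "HOL-Library.Countable_Set"
begin

section \<open>Categories as sets of arrows\<close>

record 'a category =
  arrows :: "'a set"
  idents :: "'a set"
  cdom :: "'a \<Rightarrow> 'a"
  ccod :: "'a \<Rightarrow> 'a"
  ccomp :: "'a \<Rightarrow> 'a \<Rightarrow> 'a" (infixl \<open>\<bullet>\<index>\<close> 70)

text \<open>
  The function \<open>ccomp\<close> is total; \<open>a \<bullet> b\<close> is meaningful only when \<open>a\<close> and \<open>b\<close> are arrows with
  \<open>cdom a = ccod b\<close>.
\<close>

locale category =
  fixes C :: "'a category" (structure)
  assumes idents_subset: "idents C \<subseteq> arrows C"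
    and dom_ident: "a \<in> arrows C \<Longrightarrow> cdom C a \<in> idents C"
    and cod_ident: "a \<in> arrows C \<Longrightarrow> ccod C a \<in> idents C"
    and ident_dom: "e \<in> idents C \<Longrightarrow> cdom C e = e"
    and ident_cod: "e \<in> idents C \<Longrightarrow> ccod C e = e"
    and comp_closed:
      "\<lbrakk>a \<in> arrows C; b \<in> arrows C; cdom C a = ccod C b\<rbrakk> \<Longrightarrow> a \<bullet> b \<in> arrows C"
    and dom_comp:
      "\<lbrakk>a \<in> arrows C; b \<in> arrows C; cdom C a = ccod C b\<rbrakk> \<Longrightarrow> cdom C (a \<bullet> b) = cdom C b"
    and cod_comp:
      "\<lbrakk>a \<in> arrows C; b \<in> arrows C; cdom C a = ccod C b\<rbrakk> \<Longrightarrow> ccod C (a \<bullet> b) = ccod C a"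
    and comp_assoc:
      "\<lbrakk>a \<in> arrows C; b \<in> arrows C; c \<in> arrows C; cdom C a = ccod C b; cdom C b = ccod C c\<rbrakk>
        \<Longrightarrow> (a \<bullet> b) \<bullet> c = a \<bullet> (b \<bullet> c)"
    and comp_dom: "a \<in> arrows C \<Longrightarrow> a \<bullet> cdom C a = a"
    and cod_comp_ident: "a \<in> arrows C \<Longrightarrow> ccod C a \<bullet> a = a"

definition principal :: "'a category \<Rightarrow> 'a \<Rightarrow> 'a set" where
  "principal C a = {a \<bullet>\<^bsub>C\<^esub> c | c. c \<in> arrows C \<and> cdom C a = ccod C c}"

definition generated :: "'a category \<Rightarrow> 'a set \<Rightarrow> 'a set" where
  "generated C X = (\<Union>x\<in>X. principal C x)"

definition finitely_aligned :: "'a category \<Rightarrow> bool" where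
  "finitely_aligned C \<longleftrightarrow> (\<forall>a \<in> arrows C. \<forall>b \<in> arrows C.
     \<exists>X. X \<subseteq> arrows C \<and> finite X \<and> principal C a \<inter> principal C b = generated C X)"

definition independent_arrows :: "'a category \<Rightarrow> 'a \<Rightarrow> 'a \<Rightarrow> bool" where
  "independent_arrows C a b \<longleftrightarrow> principal C a \<inter> principal C b = {}"

definition large_in :: "'a category \<Rightarrow> 'a set \<Rightarrow> 'a \<Rightarrow> bool" where
  "large_in C X a \<longleftrightarrow>
     X \<subseteq> principal C a \<and> (\<forall>b \<in> principal C a. \<exists>x \<in> X. \<not> independent_arrows C b x)"


section \<open>Higher rank graphs\<close>

text \<open>
  The number \<open>k \<ge> 1\<close> is \<open>CARD('k)\<close>, and \<open>nat ^ 'k\<close> carries componentwise addition.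
\<close>

locale higher_rank_graph = category C for C :: "'a category" (structure) +
  fixes deg :: "'a \<Rightarrow> nat ^ 'k"
  assumes countable_arrows: "countable (arrows C)"
    and deg_ident: "e \<in> idents C \<Longrightarrow> deg e = 0"
    and deg_comp:
      "\<lbrakk>a \<in> arrows C; b \<in> arrows C; cdom C a = ccod C b\<rbrakk> \<Longrightarrow> deg (a \<bullet> b) = deg a + deg b"
    and unique_factorization:
      "\<lbrakk>a \<in> arrows C; deg a = m + n\<rbrakk> \<Longrightarrow>
        \<exists>!(a1, a2). a1 \<in> arrows C \<and> a2 \<in> arrows C \<and> cdom C a1 = ccod C a2 \<and>
          a = a1 \<bullet> a2 \<and> deg a1 = m \<and> deg a2 = n"

definition no_sources :: "'a category \<Rightarrow> ('a \<Rightarrow> nat ^ 'k) \<Rightarrow> bool" where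
  "no_sources C deg \<longleftrightarrow>
     (\<forall>e \<in> idents C. \<forall>m. \<exists>x \<in> arrows C. ccod C x = e \<and> deg x = m)"

definition row_finite :: "'a category \<Rightarrow> ('a \<Rightarrow> nat ^ 'k) \<Rightarrow> bool" where
  "row_finite C deg \<longleftrightarrow> (\<forall>e \<in> idents C. \<forall>m. finite {x \<in> principal C e. deg x = m})"

definition aperiodic_category :: "'a category \<Rightarrow> bool" where
  "aperiodic_category C \<longleftrightarrow> (\<forall>a \<in> arrows C. \<forall>b \<in> arrows C. a \<noteq> b \<and> cdom C a = cdom C b \<longrightarrow>
     (\<exists>u \<in> arrows C. ccod C u = cdom C a \<and> independent_arrows C (a \<bullet>\<^bsub>C\<^esub> u) (b \<bullet>\<^bsub>C\<^esub> u)))"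

definition cofinal_category :: "'a category \<Rightarrow> bool" where
  "cofinal_category C \<longleftrightarrow> (\<forall>e \<in> idents C. \<forall>f \<in> idents C. \<exists>X. finite X \<and> large_in C X f \<and>
     (\<forall>x \<in> X. \<exists>a \<in> arrows C. ccod C a = e \<and> cdom C a = cdom C x))"


section \<open>Inverse monoids\<close>

definition sinv :: "('s, 'm) monoid_scheme \<Rightarrow> 's \<Rightarrow> 's" where
  "sinv S a = (THE b. b \<in> carrier S \<and>
     a \<otimes>\<^bsub>S\<^esub> b \<otimes>\<^bsub>S\<^esub> a = a \<and> b \<otimes>\<^bsub>S\<^esub> a \<otimes>\<^bsub>S\<^esub> b = b)"

locale inverse_monoid = monoid S for S (structure) +
  assumes inverse_ex1:
    "a \<in> carrier S \<Longrightarrow> \<exists>!b. b \<in> carrier S \<and> a \<otimes> b \<otimes> a = a \<and> b \<otimes> a \<otimes> b = b"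

definition is_zero :: "('s, 'm) monoid_scheme \<Rightarrow> 's \<Rightarrow> bool" where
  "is_zero S z \<longleftrightarrow> z \<in> carrier S \<and> (\<forall>a \<in> carrier S. z \<otimes>\<^bsub>S\<^esub> a = z \<and> a \<otimes>\<^bsub>S\<^esub> z = z)"

definition zero_of :: "('s, 'm) monoid_scheme \<Rightarrow> 's" where
  "zero_of S = (THE z. is_zero S z)"

definition idempotents :: "('s, 'm) monoid_scheme \<Rightarrow> 's set" where
  "idempotents S = {e \<in> carrier S. e \<otimes>\<^bsub>S\<^esub> e = e}"

definition natural_order :: "('s, 'm) monoid_scheme \<Rightarrow> 's gorder" where
  "natural_order S =
     \<lparr>carrier = carrier S, eq = (=), le = (\<lambda>a b. a = b \<otimes>\<^bsub>S\<^esub> sinv S a \<otimes>\<^bsub>S\<^esub> a)\<rparr>"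

definition idempotent_order :: "('s, 'm) monoid_scheme \<Rightarrow> 's gorder" where
  "idempotent_order S = (natural_order S) \<lparr>carrier := idempotents S\<rparr>"

definition compatible :: "('s, 'm) monoid_scheme \<Rightarrow> 's \<Rightarrow> 's \<Rightarrow> bool" where
  "compatible S a b \<longleftrightarrow>
     sinv S a \<otimes>\<^bsub>S\<^esub> b \<in> idempotents S \<and> a \<otimes>\<^bsub>S\<^esub> sinv S b \<in> idempotents S"

definition lenz :: "('s, 'm) monoid_scheme \<Rightarrow> ('s \<times> 's) set" where
  "lenz S = (let below = (\<lambda>x s. x \<in> carrier S \<and> x \<noteq> zero_of S \<and> x \<sqsubseteq>\<^bsub>natural_order S\<^esub> s) in
     {(s, t). s \<in> carrier S \<and> t \<in> carrier S \<and>
        (\<forall>x. below x s \<longrightarrow> (\<exists>z. below z x \<and> below z t)) \<and>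
        (\<forall>y. below y t \<longrightarrow> (\<exists>z. below z y \<and> below z s))})"

definition quotient_monoid :: "('s, 'm) monoid_scheme \<Rightarrow> ('s \<times> 's) set \<Rightarrow> 's set monoid" where
  "quotient_monoid S r =
     \<lparr>carrier = carrier S // r,
      mult = (\<lambda>A B. \<Union>a\<in>A. \<Union>b\<in>B. r `` {a \<otimes>\<^bsub>S\<^esub> b}),
      one = r `` {\<one>\<^bsub>S\<^esub>}\<rparr>"

text \<open>The one-element Boolean algebra is allowed.\<close>

locale boolean_lattice = bounded_lattice L for L (structure) +
  assumes meet_join_distrib:
    "\<lbrakk>x \<in> carrier L; y \<in> carrier L; z \<in> carrier L\<rbrakk> \<Longrightarrow> x \<sqinter> (y \<squnion> z) = (x \<sqinter> y) \<squnion> (x \<sqinter> z)"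
    and complement_ex:
    "x \<in> carrier L \<Longrightarrow> \<exists>y \<in> carrier L. x \<sqinter> y = \<bottom> \<and> x \<squnion> y = \<top>"

locale boolean_inverse_monoid = inverse_monoid S for S (structure) +
  assumes zero_ex: "\<exists>z. is_zero S z"
    and compatible_join_ex:
      "\<lbrakk>a \<in> carrier S; b \<in> carrier S; compatible S a b\<rbrakk> \<Longrightarrow>
        \<exists>j. least (natural_order S) j (Upper (natural_order S) {a, b})"
    and mult_join_distrib_left:
      "\<lbrakk>a \<in> carrier S; b \<in> carrier S; c \<in> carrier S; compatible S a b\<rbrakk> \<Longrightarrow>
        least (natural_order S) (c \<otimes> (a \<squnion>\<^bsub>natural_order S\<^esub> b))
          (Upper (natural_order S) {c \<otimes> a, c \<otimes> b})"
    and mult_join_distrib_right: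
      "\<lbrakk>a \<in> carrier S; b \<in> carrier S; c \<in> carrier S; compatible S a b\<rbrakk> \<Longrightarrow>
        least (natural_order S) ((a \<squnion>\<^bsub>natural_order S\<^esub> b) \<otimes> c)
          (Upper (natural_order S) {a \<otimes> c, b \<otimes> c})"
    and boolean_idempotents: "boolean_lattice (idempotent_order S)"

definition fundamental :: "('s, 'm) monoid_scheme \<Rightarrow> bool" where
  "fundamental S \<longleftrightarrow>
     (\<forall>a \<in> carrier S. (\<forall>e \<in> idempotents S. a \<otimes>\<^bsub>S\<^esub> e = e \<otimes>\<^bsub>S\<^esub> a) \<longrightarrow> a \<in> idempotents S)"

text \<open>Semigroup ideals are non-empty; otherwise no monoid would be \<open>0\<close>-simplifying.\<close>

definition additive_ideal :: "('s, 'm) monoid_scheme \<Rightarrow> 's set \<Rightarrow> bool" where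
  "additive_ideal S I \<longleftrightarrow>
     I \<subseteq> carrier S \<and> I \<noteq> {} \<and>
     (\<forall>a \<in> I. \<forall>s \<in> carrier S. a \<otimes>\<^bsub>S\<^esub> s \<in> I \<and> s \<otimes>\<^bsub>S\<^esub> a \<in> I) \<and>
     (\<forall>a \<in> I. \<forall>b \<in> I. compatible S a b \<longrightarrow> a \<squnion>\<^bsub>natural_order S\<^esub> b \<in> I)"

definition zero_simplifying :: "('s, 'm) monoid_scheme \<Rightarrow> bool" where
  "zero_simplifying S \<longleftrightarrow> (\<forall>I. additive_ideal S I \<longrightarrow> I = {zero_of S} \<or> I = carrier S)"

text \<open>The following notion is meant for Boolean inverse monoids only.\<close>

definition simple :: "('s, 'm) monoid_scheme \<Rightarrow> bool" where
  "simple S \<longleftrightarrow> fundamental S \<and> zero_simplifying S"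


section \<open>The monoids \<open>R(C)\<close> and \<open>B(C)\<close>\<close>

definition right_ideal :: "'a category \<Rightarrow> 'a set \<Rightarrow> bool" where
  "right_ideal C R \<longleftrightarrow> R \<subseteq> arrows C \<and> generated C R \<subseteq> R"

definition fg_right_ideal :: "'a category \<Rightarrow> 'a set \<Rightarrow> bool" where
  "fg_right_ideal C R \<longleftrightarrow>
     right_ideal C R \<and> (\<exists>X. X \<subseteq> arrows C \<and> finite X \<and> R = generated C X)"

text \<open>
  Partial bijections of \<open>arrows C\<close> are represented as partial maps; the domain of definition and
  the image are then given by \<open>dom\<close> and \<open>ran\<close>.
\<close>

definition bijective_morphism :: "'a category \<Rightarrow> 'a set \<Rightarrow> 'a set \<Rightarrow> ('a \<rightharpoonup> 'a) \<Rightarrow> bool" where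
  "bijective_morphism C R1 R2 \<theta> \<longleftrightarrow>
     right_ideal C R1 \<and> right_ideal C R2 \<and>
     dom \<theta> = R1 \<and> ran \<theta> = R2 \<and> inj_on \<theta> R1 \<and>
     (\<forall>r \<in> R1. cdom C (the (\<theta> r)) = cdom C r) \<and>
     (\<forall>r \<in> R1. \<forall>c \<in> arrows C. cdom C r = ccod C c \<longrightarrow>
        \<theta> (r \<bullet>\<^bsub>C\<^esub> c) = Some (the (\<theta> r) \<bullet>\<^bsub>C\<^esub> c))"

definition R_monoid :: "'a category \<Rightarrow> ('a \<rightharpoonup> 'a) monoid" where
  "R_monoid C =
     \<lparr>carrier = {\<theta>. \<exists>R1 R2. fg_right_ideal C R1 \<and> fg_right_ideal C R2 \<and>
                      bijective_morphism C R1 R2 \<theta>},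
      mult = (\<circ>\<^sub>m),
      one = Some |` arrows C\<rparr>"

definition B_monoid :: "'a category \<Rightarrow> ('a \<rightharpoonup> 'a) set monoid" where
  "B_monoid C = quotient_monoid (R_monoid C) (lenz (R_monoid C))"

end

theory Submission
  imports Defs
begin

text \<open>
  The proof replaces the abstract quotient \<open>B(C)\<close> by a concrete monoid of partial bijections.
  An infinite path is a set \<open>\<omega>\<close> of arrows that contains exactly one arrow of each degree and is closed
  under taking prefixes.  An element \<open>\<theta>\<close> of \<open>R(C)\<close> moves the path \<open>\<omega>\<close> whenever \<open>\<omega>\<close> meets the domain of
  \<open>\<theta>\<close>: if \<open>a \<in> \<omega>\<close> and \<open>\<theta> a = b\<close>, the initial segment \<open>a\<close> of \<open>\<omega>\<close> is replaced by \<open>b\<close>.  On bare paths this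
  action is too coarse: if \<open>C\<close> is periodic, \<open>a\<close> and \<open>b\<close> may be different although replacing \<open>a\<close> by \<open>b\<close>
  fixes every path through \<open>a\<close>.  Therefore paths carry an additional integer vector to which \<open>\<theta>\<close> adds
  \<open>deg b - deg a\<close>.  The resulting action on the graded paths \<open>(\<omega>, z)\<close> separates exactly the Lenz classes
  (\<open>lenz_iff_moves\<close>).  One direction needs compactness: the set on which two elements of \<open>R(C)\<close>
  agree is a finitely generated ideal, because \<open>C\<close> is finitely aligned and right cancellative,
  and membership of a path in such an ideal is visible at one fixed degree.  The other direction
  holds because two arrows of equal degree on one path are equal.

  So \<open>B(C)\<close> is isomorphic to a monoid of partial bijections of the graded paths.  Such a monoid is a
  Boolean inverse monoid as soon as it is closed under inverses, unions of compatible elements and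
  complements of idempotents.  Compatible unions can be formed already in \<open>R(C)\<close>
  (\<open>compatible_union_in_R\<close>).  For complements, row finiteness and the finiteness of the set of
  identities give only finitely many arrows of a given degree; if it is large, those outside an ideal
  generate its complement (\<open>complement_ideal\<close>).

  In this model the two halves of simplicity correspond to the two conditions on \<open>C\<close> separately.
  An element commutes with all idempotents iff it fixes the underlying path of every graded path
  in its domain.  If \<open>C\<close> is aperiodic and \<open>\<theta> a = b \<noteq> a\<close>, then for some \<open>u\<close> every path
  through \<open>a \<bullet> u\<close> is moved to one that misses \<open>a \<bullet> u\<close>.  If \<open>a\<close> and \<open>b\<close> violate aperiodicity, then
  \<open>a \<bullet> c \<mapsto> b \<bullet> c\<close> fixes all paths through \<open>a\<close>; as \<open>a\<close> and \<open>b\<close> are different arrows on one path, their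
  degrees differ, so the integer vector is shifted and the element is not idempotent.
  For cofinality, an additive ideal that contains the projection of \<open>a C\<close> also contains that of
  \<open>x C\<close> whenever some arrow leads from \<open>cdom C x\<close> to \<open>cdom C a\<close>.  Cofinality makes finitely many such
  \<open>x C\<close> cover all paths; conversely, for an identity \<open>e\<close> the elements whose domain consists of
  arrows \<open>x\<close> with an arrow from \<open>cdom C x\<close> to \<open>e\<close> form an additive ideal, and if it is everything,
  every identity \<open>f\<close> has the required large set.
\<close>

section \<open>Monoids of partial bijections\<close>

text \<open>
  A faithful representation of a multiplicative structure by partial bijections, closed under
  converses and containing the empty map.  Injectivity of each map \<open>\<phi> a\<close> is encoded in the existence of
  an element representing its converse.  Both \<open>R(C)\<close> (by itself) and \<open>B(C)\<close> (by its action on graded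
  paths) are instances, so the inverse-semigroup notions have to be computed only once.
\<close>

locale partial_bijection_rep =
  fixes S :: "('s, 'm) monoid_scheme" (structure) and \<phi> :: "'s \<Rightarrow> 'x \<rightharpoonup> 'x" and U :: "'x set"
  assumes rep_inj: "inj_on \<phi> (carrier S)"
    and mult_closed: "\<lbrakk>a \<in> carrier S; b \<in> carrier S\<rbrakk> \<Longrightarrow> a \<otimes> b \<in> carrier S"
    and one_closed: "\<one> \<in> carrier S"
    and rep_one: "\<phi> \<one> = Some |` U"
    and rep_within: "\<lbrakk>a \<in> carrier S; \<phi> a x = Some y\<rbrakk> \<Longrightarrow> x \<in> U"
    and rep_mult: "\<lbrakk>a \<in> carrier S; b \<in> carrier S\<rbrakk> \<Longrightarrow> \<phi> (a \<otimes> b) = \<phi> a \<circ>\<^sub>m \<phi> b"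
    and rep_converse: "a \<in> carrier S \<Longrightarrow> \<exists>b\<in>carrier S. \<forall>x y. \<phi> b y = Some x \<longleftrightarrow> \<phi> a x = Some y"
    and rep_empty: "\<exists>z\<in>carrier S. \<phi> z = Map.empty"
begin

lemma mult_Some:
  "\<lbrakk>a \<in> carrier S; b \<in> carrier S\<rbrakk> \<Longrightarrow>
    \<phi> (a \<otimes> b) x = Some z \<longleftrightarrow> (\<exists>y. \<phi> b x = Some y \<and> \<phi> a y = Some z)"
  by (simp add: rep_mult map_comp_Some_iff)

lemma one_Some: "\<phi> \<one> x = Some y \<longleftrightarrow> x \<in> U \<and> y = x"
  by (auto simp: rep_one restrict_map_def)

lemma rep_within_range: "\<lbrakk>a \<in> carrier S; \<phi> a x = Some y\<rbrakk> \<Longrightarrow> y \<in> U"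
  using rep_converse rep_within by metis

lemma rep_injective: "\<lbrakk>a \<in> carrier S; \<phi> a x = Some y; \<phi> a x' = Some y\<rbrakk> \<Longrightarrow> x = x'"
  using rep_converse by (metis option.inject)

lemma rep_eqI:
  assumes "a \<in> carrier S" "b \<in> carrier S" "\<And>x y. \<phi> a x = Some y \<longleftrightarrow> \<phi> b x = Some y"
  shows "a = b"
proof -
  have "\<phi> a = \<phi> b"
    using assms(3) by (intro ext) (metis not_Some_eq)
  then show ?thesis
    using rep_inj assms by (auto dest: inj_onD)
qed

lemma monoid_S: "monoid S"
proof
  fix x y z assume xyz: "x \<in> carrier S" "y \<in> carrier S" "z \<in> carrier S"
  show "(x \<otimes> y) \<otimes> z = x \<otimes> (y \<otimes> z)"
    by (rule rep_eqI) (auto simp: xyz mult_closed mult_Some)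
next
  fix x assume x: "x \<in> carrier S"
  show "\<one> \<otimes> x = x" "x \<otimes> \<one> = x"
    by (rule rep_eqI; use x in \<open>auto simp: mult_closed one_closed mult_Some one_Some rep_within rep_within_range\<close>)+
qed (auto simp: mult_closed one_closed)

text \<open>
  The equation \<open>a b a = a\<close> forces \<open>b\<close> to undo \<open>a\<close> on its range, by injectivity of \<open>\<phi> a\<close>; the second
  equation does the same with the roles exchanged, so \<open>b\<close> has no further values.
\<close>

lemma inverse_iff_converse:
  assumes a: "a \<in> carrier S" and b: "b \<in> carrier S"
  shows "a \<otimes> b \<otimes> a = a \<and> b \<otimes> a \<otimes> b = b \<longleftrightarrow> (\<forall>x y. \<phi> b y = Some x \<longleftrightarrow> \<phi> a x = Some y)"
    (is "?L \<longleftrightarrow> ?R")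
proof
  assume L: ?L
  have 1: "\<phi> q y = Some x" if pq: "p \<otimes> q \<otimes> p = p" "\<phi> p x = Some y" "p \<in> carrier S" "q \<in> carrier S" for p q x y
  proof -
    have "\<phi> (p \<otimes> q \<otimes> p) x = Some y" using that by simp
    then obtain u where "\<phi> q y = Some u" "\<phi> p u = Some y"
      using pq(2-) by (auto simp: mult_Some mult_closed)
    then show ?thesis using pq rep_injective by metis
  qed
  show ?R using 1 L a b by blast
next
  assume R: ?R
  have "p \<otimes> q \<otimes> p = p" if p: "p \<in> carrier S" and q: "q \<in> carrier S"
    and conv: "\<And>x y. \<phi> q y = Some x \<longleftrightarrow> \<phi> p x = Some y" for p q
  proof (rule rep_eqI)
    show "\<phi> (p \<otimes> q \<otimes> p) x = Some y \<longleftrightarrow> \<phi> p x = Some y" for x y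
      unfolding mult_Some[OF mult_closed[OF p q] p] mult_Some[OF p q] conv by auto
  qed (auto intro: mult_closed p q)
  from this[of a b] this[of b a] show ?L using a b R by blast
qed

lemma ex1_inverse:
  assumes a: "a \<in> carrier S"
  shows "\<exists>!b. b \<in> carrier S \<and> a \<otimes> b \<otimes> a = a \<and> b \<otimes> a \<otimes> b = b"
proof -
  obtain b where b: "b \<in> carrier S" "\<forall>x y. \<phi> b y = Some x \<longleftrightarrow> \<phi> a x = Some y"
    using rep_converse a by blast
  show ?thesis
  proof (rule ex1I[of _ b])
    show "b \<in> carrier S \<and> a \<otimes> b \<otimes> a = a \<and> b \<otimes> a \<otimes> b = b"
      using b a inverse_iff_converse by blast
    fix c assume c: "c \<in> carrier S \<and> a \<otimes> c \<otimes> a = a \<and> c \<otimes> a \<otimes> c = c"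
    then have "\<forall>x y. \<phi> c y = Some x \<longleftrightarrow> \<phi> a x = Some y"
      using a inverse_iff_converse by blast
    then show "c = b" using b c by (intro rep_eqI) auto
  qed
qed

lemma inverse_monoid_S: "inverse_monoid S"
  by (intro inverse_monoid.intro inverse_monoid_axioms.intro monoid_S ex1_inverse)

lemma sinv_inverse:
  "a \<in> carrier S \<Longrightarrow> sinv S a \<in> carrier S \<and> a \<otimes> sinv S a \<otimes> a = a \<and> sinv S a \<otimes> a \<otimes> sinv S a = sinv S a"
  unfolding sinv_def by (rule theI') (rule ex1_inverse)

lemma sinv_closed: "a \<in> carrier S \<Longrightarrow> sinv S a \<in> carrier S"
  using sinv_inverse by blast

lemma sinv_Some: "a \<in> carrier S \<Longrightarrow> \<phi> (sinv S a) y = Some x \<longleftrightarrow> \<phi> a x = Some y"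
  using sinv_inverse inverse_iff_converse by blast

text \<open>
  \<open>b a\<inverse> a\<close> is the restriction of \<open>b\<close> to the domain of \<open>a\<close>, so the natural order is
  extension of partial maps.
\<close>

lemma le_iff:
  assumes "a \<in> carrier S" "b \<in> carrier S"
  shows "a \<sqsubseteq>\<^bsub>natural_order S\<^esub> b \<longleftrightarrow> (\<forall>x y. \<phi> a x = Some y \<longrightarrow> \<phi> b x = Some y)"
    (is "_ \<longleftrightarrow> ?R")
proof -
  have eq: "\<phi> (b \<otimes> sinv S a \<otimes> a) x = Some y \<longleftrightarrow> (\<exists>z. \<phi> a x = Some z) \<and> \<phi> b x = Some y" for x y
    using assms rep_injective
    by (auto simp: mult_Some mult_closed sinv_closed sinv_Some)
  have "a = b \<otimes> sinv S a \<otimes> a \<longleftrightarrow> (\<forall>x y. \<phi> a x = Some y \<longleftrightarrow> \<phi> (b \<otimes> sinv S a \<otimes> a) x = Some y)"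
    using assms by (metis rep_eqI mult_closed sinv_closed)
  also have "\<dots> \<longleftrightarrow> ?R"
    unfolding eq by (metis option.inject)
  finally show ?thesis by (simp add: natural_order_def)
qed

lemma zero_iff: "is_zero S z \<longleftrightarrow> z \<in> carrier S \<and> \<phi> z = Map.empty"
proof
  assume z: "is_zero S z"
  obtain n where n: "n \<in> carrier S" "\<phi> n = Map.empty" using rep_empty by blast
  have "z \<otimes> n = z" "z \<in> carrier S" using z n by (auto simp: is_zero_def)
  then show "z \<in> carrier S \<and> \<phi> z = Map.empty"
    using n rep_mult[of z n] by (auto simp: map_comp_def)
next
  assume z: "z \<in> carrier S \<and> \<phi> z = Map.empty"
  show "is_zero S z" unfolding is_zero_def
    by (intro conjI ballI; (rule rep_eqI)?) (use z in \<open>auto simp: mult_Some mult_closed\<close>)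
qed

lemma zero_of: "is_zero S (zero_of S)"
proof -
  obtain n where n: "n \<in> carrier S" "\<phi> n = Map.empty" using rep_empty by blast
  have "\<exists>!z. is_zero S z"
    by (rule ex1I[of _ n]) (use n in \<open>auto simp: zero_iff intro: rep_eqI\<close>)
  then show ?thesis unfolding zero_of_def by (rule theI')
qed

lemma zero_closed: "zero_of S \<in> carrier S" and rep_zero: "\<phi> (zero_of S) = Map.empty"
  using zero_of zero_iff by blast+

lemma eq_zero_iff: "a \<in> carrier S \<Longrightarrow> a = zero_of S \<longleftrightarrow> \<phi> a = Map.empty"
  using rep_zero zero_closed by (auto intro: rep_eqI)

lemma idempotent_iff:
  "e \<in> idempotents S \<longleftrightarrow> e \<in> carrier S \<and> (\<forall>x y. \<phi> e x = Some y \<longrightarrow> y = x)"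
proof
  assume e: "e \<in> idempotents S"
  show "e \<in> carrier S \<and> (\<forall>x y. \<phi> e x = Some y \<longrightarrow> y = x)"
  proof (intro conjI allI impI)
    show eS: "e \<in> carrier S" using e by (simp add: idempotents_def)
    fix x y assume xy: "\<phi> e x = Some y"
    then have "\<phi> (e \<otimes> e) x = Some y" using e by (simp add: idempotents_def)
    then have "\<phi> e y = Some y" using eS xy by (auto simp: mult_Some)
    then show "y = x" using eS xy rep_injective by blast
  qed
next
  assume e: "e \<in> carrier S \<and> (\<forall>x y. \<phi> e x = Some y \<longrightarrow> y = x)"
  have eS: "e \<in> carrier S" and id: "\<And>x y. \<phi> e x = Some y \<Longrightarrow> y = x"
    using e by blast+
  have "e \<otimes> e = e"
  proof (rule rep_eqI)
    show "\<phi> (e \<otimes> e) x = Some y \<longleftrightarrow> \<phi> e x = Some y" for x y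
      unfolding mult_Some[OF eS eS] by (metis id)
  qed (auto simp: eS mult_closed)
  then show "e \<in> idempotents S" using e by (simp add: idempotents_def)
qed

lemma compatible_iff:
  assumes "a \<in> carrier S" "b \<in> carrier S"
  shows "compatible S a b \<longleftrightarrow>
    (\<forall>x y z. \<phi> a x = Some y \<and> \<phi> b x = Some z \<longrightarrow> y = z) \<and>
    (\<forall>x y z. \<phi> a x = Some z \<and> \<phi> b y = Some z \<longrightarrow> x = y)"
  using assms
  by (simp add: compatible_def idempotent_iff mult_Some mult_closed sinv_closed sinv_Some) blast

end

text \<open>
  Closure under compatible unions and under complements of partial identities is what makes a
  monoid of partial bijections Boolean: joins are unions, and the idempotents are a field of
  subsets of \<open>U\<close>.
\<close>

locale boolean_partial_bijection_rep = partial_bijection_rep +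
  assumes rep_union: "\<lbrakk>a \<in> carrier S; b \<in> carrier S;
      \<And>x y z. \<phi> a x = Some y \<Longrightarrow> \<phi> b x = Some z \<Longrightarrow> y = z;
      \<And>x y z. \<phi> a x = Some z \<Longrightarrow> \<phi> b y = Some z \<Longrightarrow> x = y\<rbrakk> \<Longrightarrow>
      \<exists>c\<in>carrier S. \<forall>x y. \<phi> c x = Some y \<longleftrightarrow> \<phi> a x = Some y \<or> \<phi> b x = Some y"
    and rep_complement: "\<lbrakk>e \<in> carrier S; \<And>x y. \<phi> e x = Some y \<Longrightarrow> y = x\<rbrakk> \<Longrightarrow>
      \<exists>f\<in>carrier S. \<forall>x y. \<phi> f x = Some y \<longleftrightarrow> x \<in> U \<and> y = x \<and> \<phi> e x = None"
begin

lemma ex_compatible_union: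
  assumes "a \<in> carrier S" "b \<in> carrier S" "compatible S a b"
  shows "\<exists>c\<in>carrier S. \<forall>x y. \<phi> c x = Some y \<longleftrightarrow> \<phi> a x = Some y \<or> \<phi> b x = Some y"
  by (rule rep_union) (use assms(3)[unfolded compatible_iff[OF assms(1,2)]] assms in blast)+

text \<open>
  The union of compatible maps is represented, so it is the join, and by antisymmetry there is no
  other one.
\<close>

lemma least_Upper_iff:
  assumes a: "a \<in> carrier S" and b: "b \<in> carrier S" and comp: "compatible S a b"
  shows "least (natural_order S) c (Upper (natural_order S) {a, b}) \<longleftrightarrow>
    c \<in> carrier S \<and> (\<forall>x y. \<phi> c x = Some y \<longleftrightarrow> \<phi> a x = Some y \<or> \<phi> b x = Some y)" (is "?L c \<longleftrightarrow> ?R c")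
proof -
  have car: "carrier (natural_order S) = carrier S" by (simp add: natural_order_def)
  have up: "u \<in> Upper (natural_order S) {a, b} \<longleftrightarrow> u \<in> carrier S \<and>
    (\<forall>x y. \<phi> a x = Some y \<or> \<phi> b x = Some y \<longrightarrow> \<phi> u x = Some y)" for u
    using a b by (auto simp: Upper_def car le_iff)
  have upsub: "Upper (natural_order S) {a, b} \<subseteq> carrier (natural_order S)"
    using up car by blast
  have R_L: "?L c" if "?R c" for c
  proof -
    have "c \<sqsubseteq>\<^bsub>natural_order S\<^esub> u" if u: "u \<in> Upper (natural_order S) {a, b}" for u
    proof -
      have "u \<in> carrier S" using u up by blast
      then show ?thesis using le_iff[of c u] \<open>?R c\<close> u[unfolded up] by blast
    qed
    moreover have "c \<in> Upper (natural_order S) {a, b}"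
      unfolding up using that by blast
    ultimately show ?thesis unfolding least_def using upsub by blast
  qed
  obtain d where d: "?R d"
    using ex_compatible_union[OF a b comp] by blast
  have "?R c" if "?L c" for c
  proof -
    have c: "c \<in> carrier S" using least_mem[OF that] unfolding up by simp
    have le: "c \<sqsubseteq>\<^bsub>natural_order S\<^esub> d" "d \<sqsubseteq>\<^bsub>natural_order S\<^esub> c"
      using least_le[OF that, of d] least_le[OF R_L[OF d], of c]
        least_mem[OF that] least_mem[OF R_L[OF d]] by simp_all
    have "c = d"
      using le[unfolded le_iff[OF c conjunct1[OF d]] le_iff[OF conjunct1[OF d] c]]
      by (intro rep_eqI c conjunct1[OF d]) blast
    then show ?thesis using d by simp
  qed
  then show ?thesis using R_L by blast
qed

lemma join_rep:
  assumes "a \<in> carrier S" "b \<in> carrier S" "compatible S a b"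
  shows "a \<squnion>\<^bsub>natural_order S\<^esub> b \<in> carrier S"
    and "\<phi> (a \<squnion>\<^bsub>natural_order S\<^esub> b) x = Some y \<longleftrightarrow> \<phi> a x = Some y \<or> \<phi> b x = Some y"
proof -
  have "\<exists>c. least (natural_order S) c (Upper (natural_order S) {a, b})"
    unfolding least_Upper_iff[OF assms] using ex_compatible_union[OF assms] by blast
  then have "least (natural_order S) (a \<squnion>\<^bsub>natural_order S\<^esub> b) (Upper (natural_order S) {a, b})"
    unfolding join_def sup_def by (rule someI_ex)
  then show "a \<squnion>\<^bsub>natural_order S\<^esub> b \<in> carrier S"
    and "\<phi> (a \<squnion>\<^bsub>natural_order S\<^esub> b) x = Some y \<longleftrightarrow> \<phi> a x = Some y \<or> \<phi> b x = Some y"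
    unfolding least_Upper_iff[OF assms] by auto
qed

lemma compatible_mult:
  assumes "a \<in> carrier S" "b \<in> carrier S" "c \<in> carrier S" "compatible S a b"
  shows "compatible S (c \<otimes> a) (c \<otimes> b)" "compatible S (a \<otimes> c) (b \<otimes> c)"
proof -
  have a: "a \<in> carrier S" and b: "b \<in> carrier S" and c: "c \<in> carrier S" by fact+
  note comp = assms(4)[unfolded compatible_iff[OF a b]]
  have ab: "\<phi> a x = Some y \<Longrightarrow> \<phi> b x = Some z \<Longrightarrow> y = z"
    and ba: "\<phi> a x = Some z \<Longrightarrow> \<phi> b y = Some z \<Longrightarrow> x = y" for x y z
    using comp by blast+
  show "compatible S (c \<otimes> a) (c \<otimes> b)"
    unfolding compatible_iff[OF mult_closed[OF c a] mult_closed[OF c b]] mult_Some[OF c a] mult_Some[OF c b]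
    using ab ba rep_injective[OF c] by (metis option.inject)
  show "compatible S (a \<otimes> c) (b \<otimes> c)"
    unfolding compatible_iff[OF mult_closed[OF a c] mult_closed[OF b c]] mult_Some[OF a c] mult_Some[OF b c]
    using ab ba rep_injective[OF c] by (metis option.inject)
qed

text \<open>
  An idempotent is a partial identity, hence determined by its domain; the lattice of idempotents is
  therefore handled through domains only.
\<close>

lemma idempotent_eqI:
  assumes "e \<in> idempotents S" "f \<in> idempotents S" "dom (\<phi> e) = dom (\<phi> f)"
  shows "e = f"
proof (rule rep_eqI)
  have "\<And>x y. \<phi> e x = Some y \<Longrightarrow> y = x" "\<And>x y. \<phi> f x = Some y \<Longrightarrow> y = x"
    using assms by (auto simp: idempotent_iff)
  then show "\<phi> e x = Some y \<longleftrightarrow> \<phi> f x = Some y" for x y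
    using assms(3) by (metis domD domI)
qed (use assms in \<open>auto simp: idempotent_iff\<close>)

lemma idempotent_le_iff:
  assumes "e \<in> idempotents S" "f \<in> idempotents S"
  shows "e \<sqsubseteq>\<^bsub>idempotent_order S\<^esub> f \<longleftrightarrow> dom (\<phi> e) \<subseteq> dom (\<phi> f)"
proof -
  have "e \<sqsubseteq>\<^bsub>idempotent_order S\<^esub> f \<longleftrightarrow> (\<forall>x y. \<phi> e x = Some y \<longrightarrow> \<phi> f x = Some y)"
    using assms le_iff[of e f] by (simp add: idempotent_order_def natural_order_def idempotents_def)
  also have "\<dots> \<longleftrightarrow> dom (\<phi> e) \<subseteq> dom (\<phi> f)"
    using assms by (fastforce simp: idempotent_iff dom_def subset_iff)
  finally show ?thesis .
qed

lemma idempotents_compatible: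
  "\<lbrakk>e \<in> idempotents S; f \<in> idempotents S\<rbrakk> \<Longrightarrow> compatible S e f"
  by (auto simp: compatible_iff idempotent_iff)

lemma ex_union_idempotent:
  assumes "e \<in> idempotents S" "f \<in> idempotents S"
  shows "\<exists>g\<in>idempotents S. dom (\<phi> g) = dom (\<phi> e) \<union> dom (\<phi> f)"
proof -
  have ef: "e \<in> carrier S" "f \<in> carrier S" using assms by (auto simp: idempotent_iff)
  obtain g where g: "g \<in> carrier S" "\<forall>x y. \<phi> g x = Some y \<longleftrightarrow> \<phi> e x = Some y \<or> \<phi> f x = Some y"
    using ex_compatible_union[OF ef idempotents_compatible[OF assms]] by blast
  have "g \<in> idempotents S" using g assms by (auto simp: idempotent_iff)
  moreover have "dom (\<phi> g) = dom (\<phi> e) \<union> dom (\<phi> f)"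
    using g by (auto simp: dom_def)
  ultimately show ?thesis by blast
qed

lemma mult_idempotents:
  assumes "e \<in> idempotents S" "f \<in> idempotents S"
  shows "e \<otimes> f \<in> idempotents S" "dom (\<phi> (e \<otimes> f)) = dom (\<phi> e) \<inter> dom (\<phi> f)"
proof -
  have e: "e \<in> carrier S" "\<And>x y. \<phi> e x = Some y \<Longrightarrow> y = x"
    and f: "f \<in> carrier S" "\<And>x y. \<phi> f x = Some y \<Longrightarrow> y = x"
    using assms by (auto simp: idempotent_iff)
  have ef: "\<phi> (e \<otimes> f) x = Some y \<longleftrightarrow> \<phi> e x = Some y \<and> \<phi> f x = Some y" for x y
    unfolding mult_Some[OF e(1) f(1)] using e(2) f(2) by metis
  show "e \<otimes> f \<in> idempotents S"
    using e f ef by (simp add: idempotent_iff mult_closed)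
  show "dom (\<phi> (e \<otimes> f)) = dom (\<phi> e) \<inter> dom (\<phi> f)"
    using e(2) f(2) ef by (fastforce simp: dom_def)
qed

lemma ex_complement_idempotent:
  assumes "e \<in> idempotents S"
  shows "\<exists>g\<in>idempotents S. dom (\<phi> g) = U - dom (\<phi> e)"
proof -
  obtain f where f: "f \<in> carrier S" "\<forall>x y. \<phi> f x = Some y \<longleftrightarrow> x \<in> U \<and> y = x \<and> \<phi> e x = None"
    using rep_complement[of e] assms by (auto simp: idempotent_iff)
  then have "f \<in> idempotents S" "dom (\<phi> f) = U - dom (\<phi> e)"
    by (auto simp: idempotent_iff dom_def)
  then show ?thesis by blast
qed

lemma zero_idempotent: "zero_of S \<in> idempotents S" "dom (\<phi> (zero_of S)) = {}"
  by (auto simp: idempotent_iff zero_closed rep_zero)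

lemma one_idempotent: "\<one> \<in> idempotents S" "dom (\<phi> \<one>) = U"
  by (auto simp: idempotent_iff one_closed one_Some dom_def)

lemma idempotent_dom: "e \<in> idempotents S \<Longrightarrow> dom (\<phi> e) \<subseteq> U"
  using rep_within by (auto simp: idempotent_iff)

lemma least_idempotent_upper:
  assumes e: "e \<in> idempotents S" and f: "f \<in> idempotents S" and g: "g \<in> idempotents S"
    and dom: "dom (\<phi> g) = dom (\<phi> e) \<union> dom (\<phi> f)"
  shows "least (idempotent_order S) g (Upper (idempotent_order S) {e, f})"
proof -
  have car: "carrier (idempotent_order S) = idempotents S" by (simp add: idempotent_order_def)
  have up: "u \<in> Upper (idempotent_order S) {e, f} \<longleftrightarrow>
    u \<in> idempotents S \<and> dom (\<phi> e) \<union> dom (\<phi> f) \<subseteq> dom (\<phi> u)" for u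
  proof -
    have "u \<in> Upper (idempotent_order S) {e, f} \<longleftrightarrow>
      u \<in> idempotents S \<and> e \<sqsubseteq>\<^bsub>idempotent_order S\<^esub> u \<and> f \<sqsubseteq>\<^bsub>idempotent_order S\<^esub> u"
      using e f by (auto simp: Upper_def car)
    then show ?thesis by (simp add: idempotent_le_iff e f cong: conj_cong)
  qed
  show ?thesis using g by (auto simp: least_def up car idempotent_le_iff dom)
qed

lemma greatest_idempotent_lower:
  assumes e: "e \<in> idempotents S" and f: "f \<in> idempotents S" and g: "g \<in> idempotents S"
    and dom: "dom (\<phi> g) = dom (\<phi> e) \<inter> dom (\<phi> f)"
  shows "greatest (idempotent_order S) g (Lower (idempotent_order S) {e, f})"
proof -
  have car: "carrier (idempotent_order S) = idempotents S" by (simp add: idempotent_order_def)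
  have low: "u \<in> Lower (idempotent_order S) {e, f} \<longleftrightarrow>
    u \<in> idempotents S \<and> dom (\<phi> u) \<subseteq> dom (\<phi> e) \<inter> dom (\<phi> f)" for u
  proof -
    have "u \<in> Lower (idempotent_order S) {e, f} \<longleftrightarrow>
      u \<in> idempotents S \<and> u \<sqsubseteq>\<^bsub>idempotent_order S\<^esub> e \<and> u \<sqsubseteq>\<^bsub>idempotent_order S\<^esub> f"
      using e f by (auto simp: Lower_def car)
    then show ?thesis by (simp add: idempotent_le_iff e f cong: conj_cong)
  qed
  show ?thesis using g by (auto simp: greatest_def low car idempotent_le_iff dom)
qed

lemma bounded_lattice_idempotents: "bounded_lattice (idempotent_order S)"
proof -
  have car: "carrier (idempotent_order S) = idempotents S" by (simp add: idempotent_order_def)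
  have eq: "x .=\<^bsub>idempotent_order S\<^esub> y \<longleftrightarrow> x = y" for x y
    by (simp add: idempotent_order_def natural_order_def)
  interpret partial_order "idempotent_order S"
    by unfold_locales (auto simp: car eq idempotent_le_iff fun_eq_iff dest: idempotent_eqI)
  show ?thesis
  proof
    fix x y assume "x \<in> carrier (idempotent_order S)" "y \<in> carrier (idempotent_order S)"
    then have xy: "x \<in> idempotents S" "y \<in> idempotents S" by (simp_all add: car)
    show "\<exists>s. least (idempotent_order S) s (Upper (idempotent_order S) {x, y})"
      using ex_union_idempotent[OF xy] least_idempotent_upper[OF xy] by blast
    show "\<exists>s. greatest (idempotent_order S) s (Lower (idempotent_order S) {x, y})"
      using mult_idempotents[OF xy] greatest_idempotent_lower[OF xy] by blast
  next
    show "\<exists>x. least (idempotent_order S) x (carrier (idempotent_order S))"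
      using zero_idempotent by (auto simp: least_def car idempotent_le_iff)
    show "\<exists>x. greatest (idempotent_order S) x (carrier (idempotent_order S))"
      using one_idempotent idempotent_dom by (auto simp: greatest_def car idempotent_le_iff)
  qed
qed

lemma boolean_lattice_idempotents: "boolean_lattice (idempotent_order S)"
proof -
  interpret bounded_lattice "idempotent_order S" by (rule bounded_lattice_idempotents)
  have car: "carrier (idempotent_order S) = idempotents S" by (simp add: idempotent_order_def)
  have join: "e \<squnion>\<^bsub>idempotent_order S\<^esub> f \<in> idempotents S \<and>
      dom (\<phi> (e \<squnion>\<^bsub>idempotent_order S\<^esub> f)) = dom (\<phi> e) \<union> dom (\<phi> f)"
    if ef: "e \<in> idempotents S" "f \<in> idempotents S" for e f
  proof -
    obtain g where g: "g \<in> idempotents S" "dom (\<phi> g) = dom (\<phi> e) \<union> dom (\<phi> f)"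
      using ex_union_idempotent[OF ef] by blast
    have "g = e \<squnion>\<^bsub>idempotent_order S\<^esub> f"
      by (rule joinI) (use ef g least_idempotent_upper[OF ef g] least_unique in \<open>auto simp: car\<close>)
    then show ?thesis using g by simp
  qed
  have meet: "e \<sqinter>\<^bsub>idempotent_order S\<^esub> f \<in> idempotents S \<and>
      dom (\<phi> (e \<sqinter>\<^bsub>idempotent_order S\<^esub> f)) = dom (\<phi> e) \<inter> dom (\<phi> f)"
    if ef: "e \<in> idempotents S" "f \<in> idempotents S" for e f
  proof -
    have "e \<otimes> f = e \<sqinter>\<^bsub>idempotent_order S\<^esub> f"
      by (rule meetI) (use ef greatest_idempotent_lower[OF ef mult_idempotents[OF ef]] greatest_unique
          in \<open>auto simp: car\<close>)
    then show ?thesis using mult_idempotents[OF ef] by simp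
  qed
  have bot: "\<bottom>\<^bsub>idempotent_order S\<^esub> = zero_of S"
    using zero_idempotent by (intro bottom_eq[symmetric]) (auto simp: car idempotent_le_iff)
  have top: "\<top>\<^bsub>idempotent_order S\<^esub> = \<one>"
    using one_idempotent idempotent_dom by (intro top_eq[symmetric]) (auto simp: car idempotent_le_iff)
  show ?thesis
  proof
    fix x y z assume "x \<in> carrier (idempotent_order S)" "y \<in> carrier (idempotent_order S)"
      "z \<in> carrier (idempotent_order S)"
    then have xyz: "x \<in> idempotents S" "y \<in> idempotents S" "z \<in> idempotents S"
      by (simp_all add: car)
    show "x \<sqinter>\<^bsub>idempotent_order S\<^esub> (y \<squnion>\<^bsub>idempotent_order S\<^esub> z) =
      x \<sqinter>\<^bsub>idempotent_order S\<^esub> y \<squnion>\<^bsub>idempotent_order S\<^esub> x \<sqinter>\<^bsub>idempotent_order S\<^esub> z"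
      by (rule idempotent_eqI) (auto simp: xyz join meet)
  next
    fix x assume "x \<in> carrier (idempotent_order S)"
    then have x: "x \<in> idempotents S" by (simp add: car)
    obtain y where y: "y \<in> idempotents S" "dom (\<phi> y) = U - dom (\<phi> x)"
      using ex_complement_idempotent[OF x] by blast
    have "x \<sqinter>\<^bsub>idempotent_order S\<^esub> y = zero_of S"
      by (rule idempotent_eqI) (simp_all add: x y meet zero_idempotent)
    moreover have "x \<squnion>\<^bsub>idempotent_order S\<^esub> y = \<one>"
      by (rule idempotent_eqI) (use idempotent_dom[OF x] in
          \<open>simp_all add: x y join one_idempotent Un_absorb1\<close>)
    ultimately show "\<exists>y\<in>carrier (idempotent_order S).
      x \<sqinter>\<^bsub>idempotent_order S\<^esub> y = \<bottom>\<^bsub>idempotent_order S\<^esub> \<and>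
      x \<squnion>\<^bsub>idempotent_order S\<^esub> y = \<top>\<^bsub>idempotent_order S\<^esub>"
      using y by (auto simp: bot top car)
  qed
qed

lemma boolean_inverse_monoid_S: "boolean_inverse_monoid S"
proof -
  show ?thesis
  proof (intro boolean_inverse_monoid.intro boolean_inverse_monoid_axioms.intro inverse_monoid_S)
    show "\<exists>z. is_zero S z" using zero_of by blast
    show "boolean_lattice (idempotent_order S)" by (rule boolean_lattice_idempotents)
    fix a b assume ab: "a \<in> carrier S" "b \<in> carrier S" "compatible S a b"
    note j = join_rep[OF ab]
    show "\<exists>j. least (natural_order S) j (Upper (natural_order S) {a, b})"
      using least_Upper_iff[OF ab] j by blast
    fix c assume c: "c \<in> carrier S"
    show "least (natural_order S) (c \<otimes> (a \<squnion>\<^bsub>natural_order S\<^esub> b))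
          (Upper (natural_order S) {c \<otimes> a, c \<otimes> b})"
      unfolding least_Upper_iff[OF mult_closed[OF c ab(1)] mult_closed[OF c ab(2)]
          compatible_mult(1)[OF ab(1,2) c ab(3)]]
      using ab j c by (auto simp: mult_closed mult_Some)
    show "least (natural_order S) ((a \<squnion>\<^bsub>natural_order S\<^esub> b) \<otimes> c)
          (Upper (natural_order S) {a \<otimes> c, b \<otimes> c})"
      unfolding least_Upper_iff[OF mult_closed[OF ab(1) c] mult_closed[OF ab(2) c]
          compatible_mult(2)[OF ab(1,2) c ab(3)]]
      using ab j c by (auto simp: mult_closed mult_Some)
  qed
qed

end


section \<open>Finitely generated right ideals and the monoid \<open>R(C)\<close>\<close>

context category
begin

abbreviation composable :: "'a \<Rightarrow> 'a \<Rightarrow> bool" where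
  "composable a c \<equiv> a \<in> arrows C \<and> c \<in> arrows C \<and> cdom C a = ccod C c"

lemma principalI: "composable a c \<Longrightarrow> a \<bullet> c \<in> principal C a"
  by (auto simp: principal_def)

lemma principalE:
  assumes "x \<in> principal C a" "a \<in> arrows C"
  obtains c where "composable a c" "x = a \<bullet> c"
  using assms by (auto simp: principal_def)

lemma ident_arrow: "e \<in> idents C \<Longrightarrow> e \<in> arrows C"
  using idents_subset by blast

lemma composable_dom: "a \<in> arrows C \<Longrightarrow> composable a (cdom C a)"
  by (simp add: dom_ident ident_arrow ident_cod)

lemma principal_self: "a \<in> arrows C \<Longrightarrow> a \<in> principal C a"
  using principalI[OF composable_dom] comp_dom by metis

lemma principal_arrows: "a \<in> arrows C \<Longrightarrow> principal C a \<subseteq> arrows C"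
  by (auto simp: principal_def comp_closed)

lemma composable_assoc':
  assumes ab: "composable a b" and bc: "composable b c"
  shows "composable (a \<bullet> b) c \<and> composable a (b \<bullet> c) \<and> (a \<bullet> b) \<bullet> c = a \<bullet> (b \<bullet> c)"
  using ab bc comp_closed[of a b] comp_closed[of b c] dom_comp[of a b] cod_comp[of b c] comp_assoc[of a b c]
  by metis

lemma composable_assoc:
  assumes ab: "composable a b" and abc: "composable (a \<bullet> b) c"
  shows "composable b c \<and> composable a (b \<bullet> c) \<and> (a \<bullet> b) \<bullet> c = a \<bullet> (b \<bullet> c)"
proof -
  have "composable b c" using ab abc dom_comp[of a b] by metis
  then show ?thesis using composable_assoc'[OF ab] by blast
qed

lemma principal_trans:
  assumes "x \<in> principal C b" "b \<in> principal C a" "a \<in> arrows C"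
  shows "x \<in> principal C a"
proof -
  obtain c where c: "composable a c" "b = a \<bullet> c" by (rule principalE[OF assms(2,3)])
  obtain d where d: "composable b d" "x = b \<bullet> d"
    by (rule principalE[OF assms(1) subsetD[OF principal_arrows[OF assms(3)] assms(2)]])
  then show ?thesis using c composable_assoc[of a c d] principalI[of a "c \<bullet> d"] by simp
qed

lemma principal_ident: "a \<in> arrows C \<Longrightarrow> a \<in> principal C (ccod C a)"
  using principalI[of "ccod C a" a] by (simp add: cod_ident ident_arrow ident_dom cod_comp_ident)

lemma principal_ident_iff: "e \<in> idents C \<Longrightarrow> a \<in> principal C e \<longleftrightarrow> a \<in> arrows C \<and> ccod C a = e"
  using principal_ident[of a] ident_arrow[of e]
  by (auto elim!: principalE simp: comp_closed cod_comp ident_cod)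

lemma generated_iff: "x \<in> generated C X \<longleftrightarrow> (\<exists>a\<in>X. x \<in> principal C a)"
  by (simp add: generated_def)

lemma generated_right_closed:
  assumes "X \<subseteq> arrows C" "a \<in> generated C X" "composable a c"
  shows "a \<bullet> c \<in> generated C X"
proof -
  obtain x where "x \<in> X" "a \<in> principal C x" using assms generated_iff by metis
  then show ?thesis using assms principal_trans[OF principalI] unfolding generated_iff by blast
qed

lemma generated_arrows: "X \<subseteq> arrows C \<Longrightarrow> generated C X \<subseteq> arrows C"
  using principal_arrows by (auto simp: generated_def)

lemma generated_superset: "X \<subseteq> arrows C \<Longrightarrow> X \<subseteq> generated C X"
  using principal_self by (fastforce simp: generated_iff)

text \<open>
  These are the finitely generated right ideals of \<open>C\<close>, by \<open>fg_right_ideal_iff\<close>.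
\<close>

definition fin_gen :: "'a set \<Rightarrow> bool" where
  "fin_gen D \<longleftrightarrow> (\<exists>X. X \<subseteq> arrows C \<and> finite X \<and> D = generated C X)"

lemma fin_gen_generated: "X \<subseteq> arrows C \<Longrightarrow> finite X \<Longrightarrow> fin_gen (generated C X)"
  by (auto simp: fin_gen_def)

lemma fin_gen_principal: "a \<in> arrows C \<Longrightarrow> fin_gen (principal C a)"
  using fin_gen_generated[of "{a}"] by (simp add: generated_def)

lemma fin_gen_arrows: "fin_gen D \<Longrightarrow> D \<subseteq> arrows C"
  using generated_arrows by (auto simp: fin_gen_def)

lemma fin_gen_right_closed: "fin_gen D \<Longrightarrow> a \<in> D \<Longrightarrow> composable a c \<Longrightarrow> a \<bullet> c \<in> D"
  using generated_right_closed by (auto simp: fin_gen_def)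

lemma fin_gen_Union:
  assumes "finite I" "\<And>i. i \<in> I \<Longrightarrow> fin_gen (D i)"
  shows "fin_gen (\<Union>i\<in>I. D i)"
proof -
  obtain X where X: "\<forall>i\<in>I. X i \<subseteq> arrows C \<and> finite (X i) \<and> D i = generated C (X i)"
    using bchoice[of I "\<lambda>i X. X \<subseteq> arrows C \<and> finite X \<and> D i = generated C X"] assms(2)
    unfolding fin_gen_def by blast
  have "(\<Union>i\<in>I. D i) = generated C (\<Union>i\<in>I. X i)" using X by (auto simp: generated_def)
  moreover have "(\<Union>i\<in>I. X i) \<subseteq> arrows C" "finite (\<Union>i\<in>I. X i)" using X assms(1) by auto
  ultimately show ?thesis unfolding fin_gen_def by blast
qed

lemma fin_gen_Un: "fin_gen D \<Longrightarrow> fin_gen E \<Longrightarrow> fin_gen (D \<union> E)"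
  using fin_gen_Union[of "{True, False}" "\<lambda>b. if b then D else E"] by (simp add: Un_commute)

text \<open>
  Intersections of principal ideals are finitely generated by finite alignment; the general case
  follows because intersection distributes over the finitely many generators.
\<close>

lemma fin_gen_Int:
  assumes fa: "finitely_aligned C" and "fin_gen D" "fin_gen E"
  shows "fin_gen (D \<inter> E)"
proof -
  obtain X Y where X: "X \<subseteq> arrows C" "finite X" "D = generated C X"
    and Y: "Y \<subseteq> arrows C" "finite Y" "E = generated C Y"
    using assms by (auto simp: fin_gen_def)
  have "D \<inter> E = (\<Union>(x, y)\<in>X \<times> Y. principal C x \<inter> principal C y)"
    using X Y by (auto simp: generated_def)
  moreover have "fin_gen (\<Union>(x, y)\<in>X \<times> Y. principal C x \<inter> principal C y)"
  proof (rule fin_gen_Union)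
    fix i assume "i \<in> X \<times> Y"
    then obtain x y where "i = (x, y)" "x \<in> arrows C" "y \<in> arrows C" using X Y by blast
    then show "fin_gen (case i of (x, y) \<Rightarrow> principal C x \<inter> principal C y)"
      using fa unfolding finitely_aligned_def fin_gen_def by simp
  qed (use X Y in simp)
  ultimately show ?thesis by simp
qed

text \<open>
  Elements of \<open>R(C)\<close> without reference to the ideals between which they act: domain and range
  are recovered from the map.
\<close>

definition ideal_embedding :: "('a \<rightharpoonup> 'a) \<Rightarrow> bool" where
  "ideal_embedding \<theta> \<longleftrightarrow>
     (\<forall>a b. \<theta> a = Some b \<longrightarrow> a \<in> arrows C \<and> b \<in> arrows C \<and> cdom C b = cdom C a) \<and>
     (\<forall>a b c. \<theta> a = Some b \<and> c \<in> arrows C \<and> cdom C a = ccod C c \<longrightarrow> \<theta> (a \<bullet> c) = Some (b \<bullet> c)) \<and>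
     (\<forall>a a' b. \<theta> a = Some b \<and> \<theta> a' = Some b \<longrightarrow> a = a')"

lemma ideal_embeddingD:
  assumes "ideal_embedding \<theta>" "\<theta> a = Some b"
  shows "a \<in> arrows C" "b \<in> arrows C" "cdom C b = cdom C a"
    and "composable a c \<Longrightarrow> \<theta> (a \<bullet> c) = Some (b \<bullet> c)"
    and "\<theta> a' = Some b \<Longrightarrow> a' = a"
  using assms unfolding ideal_embedding_def by blast+

text \<open>
  A morphism maps generators of an ideal to generators of its image.
\<close>

lemma fin_gen_image:
  assumes \<theta>: "ideal_embedding \<theta>" and D: "fin_gen D" "D \<subseteq> dom \<theta>"
  shows "fin_gen {b. \<exists>a\<in>D. \<theta> a = Some b}"
proof -
  obtain X where X: "X \<subseteq> arrows C" "finite X" "D = generated C X"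
    using D by (auto simp: fin_gen_def)
  have Xdom: "\<exists>b. \<theta> x = Some b" if "x \<in> X" for x
    using that X D(2) generated_superset[OF X(1)] by blast
  let ?Y = "(\<lambda>x. the (\<theta> x)) ` X"
  have Y: "?Y \<subseteq> arrows C" using Xdom ideal_embeddingD(2)[OF \<theta>] by force
  have "{b. \<exists>a\<in>D. \<theta> a = Some b} = generated C ?Y"
  proof (intro subset_antisym subsetI)
    fix b assume "b \<in> {b. \<exists>a\<in>D. \<theta> a = Some b}"
    then obtain a x where a: "x \<in> X" "a \<in> principal C x" "\<theta> a = Some b"
      unfolding X(3) by (auto simp: generated_iff)
    obtain c where c: "composable x c" "a = x \<bullet> c"
      using principalE[OF a(2)] a(1) X(1) by blast
    obtain y where y: "\<theta> x = Some y" using Xdom a by blast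
    have "b = y \<bullet> c" using a c ideal_embeddingD(4)[OF \<theta> y c(1)] by simp
    then have "b \<in> principal C y"
      using principalI[of y c] c ideal_embeddingD(2,3)[OF \<theta> y] by simp
    then show "b \<in> generated C ?Y" using y a by (force simp: generated_iff)
  next
    fix b assume "b \<in> generated C ?Y"
    then obtain x where x: "x \<in> X" "b \<in> principal C (the (\<theta> x))" by (auto simp: generated_iff)
    obtain y where y: "\<theta> x = Some y" using Xdom x by blast
    note y' = ideal_embeddingD[OF \<theta> y]
    obtain c where c: "composable y c" "b = y \<bullet> c"
      using principalE[of b y] x(2) y y'(2) by auto
    have "composable x c" using c y' by simp
    then show "b \<in> {b. \<exists>a\<in>D. \<theta> a = Some b}"
      using c y'(4) X generated_right_closed x generated_superset by blast
  qed
  then show ?thesis using Y X(2) unfolding fin_gen_def by blast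
qed

lemma fin_gen_ran:
  assumes "ideal_embedding \<theta>" "fin_gen (dom \<theta>)"
  shows "fin_gen (ran \<theta>)"
proof -
  have "ran \<theta> = {b. \<exists>a\<in>dom \<theta>. \<theta> a = Some b}" by (auto simp: ran_def)
  then show ?thesis using fin_gen_image[OF assms] by simp
qed

lemma fin_gen_right_ideal: "fin_gen D \<Longrightarrow> right_ideal C D"
  using fin_gen_arrows fin_gen_right_closed
  by (auto simp: right_ideal_def generated_iff subset_iff elim!: principalE)

lemma fg_right_ideal_iff: "fg_right_ideal C D \<longleftrightarrow> fin_gen D"
  using fin_gen_right_ideal by (auto simp: fg_right_ideal_def fin_gen_def)

text \<open>
  The range is finitely generated because it is the image of the finitely generated domain.
\<close>

lemma R_carrier_iff:
  "\<theta> \<in> carrier (R_monoid C) \<longleftrightarrow> ideal_embedding \<theta> \<and> fin_gen (dom \<theta>)"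
proof
  assume "\<theta> \<in> carrier (R_monoid C)"
  then obtain R1 R2 where R: "fg_right_ideal C R1" "fg_right_ideal C R2" "bijective_morphism C R1 R2 \<theta>"
    by (auto simp: R_monoid_def)
  have d: "dom \<theta> = R1" "ran \<theta> = R2" "inj_on \<theta> R1" and
    m: "\<forall>r\<in>R1. cdom C (the (\<theta> r)) = cdom C r"
      "\<forall>r \<in> R1. \<forall>c \<in> arrows C. cdom C r = ccod C c \<longrightarrow> \<theta> (r \<bullet> c) = Some (the (\<theta> r) \<bullet> c)"
    using R(3) by (auto simp: bijective_morphism_def)
  have sub: "R1 \<subseteq> arrows C" "R2 \<subseteq> arrows C" using R(1,2) by (auto simp: fg_right_ideal_def right_ideal_def)
  have "ideal_embedding \<theta>" unfolding ideal_embedding_def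
  proof (intro conjI allI impI)
    fix a b assume ab: "\<theta> a = Some b"
    then have a: "a \<in> R1" "b \<in> R2" using d ranI[of \<theta> a b] by blast+
    then show "a \<in> arrows C" "b \<in> arrows C" using sub by blast+
    show "cdom C b = cdom C a" using bspec[OF m(1) a(1)] ab by simp
  next
    fix a b c assume "\<theta> a = Some b \<and> c \<in> arrows C \<and> cdom C a = ccod C c"
    moreover from this have "a \<in> R1" using d by blast
    ultimately show "\<theta> (a \<bullet> c) = Some (b \<bullet> c)" using m(2) by simp
  next
    fix a a' b assume "\<theta> a = Some b \<and> \<theta> a' = Some b"
    then show "a = a'" using d by (metis domI inj_onD)
  qed
  then show "ideal_embedding \<theta> \<and> fin_gen (dom \<theta>)" using R d fg_right_ideal_iff by simp
next
  assume a: "ideal_embedding \<theta> \<and> fin_gen (dom \<theta>)"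
  have "bijective_morphism C (dom \<theta>) (ran \<theta>) \<theta>"
    unfolding bijective_morphism_def
    using a fin_gen_right_ideal fin_gen_ran[of \<theta>]
    by (auto simp: ideal_embedding_def inj_on_def)
  then show "\<theta> \<in> carrier (R_monoid C)"
    using a fg_right_ideal_iff fin_gen_ran[of \<theta>] by (auto simp: R_monoid_def)
qed

lemma R_one: "\<one>\<^bsub>R_monoid C\<^esub> = Some |` arrows C" and R_mult: "\<theta> \<otimes>\<^bsub>R_monoid C\<^esub> \<eta> = \<theta> \<circ>\<^sub>m \<eta>"
  by (simp_all add: R_monoid_def)

lemma restrict_Some: "(Some |` D) a = Some b \<longleftrightarrow> a \<in> D \<and> b = a"
  by (auto simp: restrict_map_def)

lemma dom_restrict_Some: "dom (Some |` D) = D"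
  by auto

lemma identity_in_R: "fin_gen D \<Longrightarrow> Some |` D \<in> carrier (R_monoid C)"
  using fin_gen_arrows[of D] fin_gen_right_closed[of D]
  unfolding R_carrier_iff ideal_embedding_def restrict_Some dom_restrict_Some by blast

lemma empty_in_R: "Map.empty \<in> carrier (R_monoid C)"
  using fin_gen_generated[of "{}"] by (simp add: R_carrier_iff ideal_embedding_def generated_def)

definition converse_map :: "('a \<rightharpoonup> 'a) \<Rightarrow> 'a \<rightharpoonup> 'a" where
  "converse_map \<theta> = (\<lambda>b. if \<exists>a. \<theta> a = Some b then Some (THE a. \<theta> a = Some b) else None)"

lemma converse_map_Some:
  assumes "ideal_embedding \<theta>"
  shows "converse_map \<theta> b = Some a \<longleftrightarrow> \<theta> a = Some b"
proof -
  have "(THE a. \<theta> a = Some b) = a" if "\<theta> a = Some b" for a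
    using that ideal_embeddingD(5)[OF assms] by blast
  then show ?thesis unfolding converse_map_def by auto
qed

lemma converse_in_R:
  assumes "\<theta> \<in> carrier (R_monoid C)"
  shows "converse_map \<theta> \<in> carrier (R_monoid C)"
proof -
  have \<theta>: "ideal_embedding \<theta>" "fin_gen (dom \<theta>)" using assms R_carrier_iff by auto
  have "ideal_embedding (converse_map \<theta>)"
    unfolding ideal_embedding_def converse_map_Some[OF \<theta>(1)]
  proof (intro conjI allI impI)
    fix a b c assume a: "\<theta> b = Some a \<and> c \<in> arrows C \<and> cdom C a = ccod C c"
    then show "\<theta> (b \<bullet> c) = Some (a \<bullet> c)"
      using ideal_embeddingD[OF \<theta>(1), of b a] by simp
  qed (auto dest: ideal_embeddingD(1-3)[OF \<theta>(1)])
  moreover have "dom (converse_map \<theta>) = ran \<theta>"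
    unfolding dom_def ran_def not_None_eq converse_map_Some[OF \<theta>(1)] by blast
  ultimately show ?thesis using fin_gen_ran[OF \<theta>] R_carrier_iff by simp
qed

text \<open>
  The domain of \<open>\<theta> \<circ>\<^sub>m \<eta>\<close> is the image under the converse of \<open>\<eta>\<close> of \<open>dom \<theta> \<inter> ran \<eta>\<close>, which is where finite
  alignment enters.
\<close>

lemma comp_in_R:
  assumes fa: "finitely_aligned C" and \<theta>: "\<theta> \<in> carrier (R_monoid C)" and \<eta>: "\<eta> \<in> carrier (R_monoid C)"
  shows "\<theta> \<circ>\<^sub>m \<eta> \<in> carrier (R_monoid C)"
proof -
  have t: "ideal_embedding \<theta>" "fin_gen (dom \<theta>)" and e: "ideal_embedding \<eta>" "fin_gen (dom \<eta>)"
    using \<theta> \<eta> R_carrier_iff by auto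
  have emb: "ideal_embedding (\<theta> \<circ>\<^sub>m \<eta>)"
    unfolding ideal_embedding_def map_comp_Some_iff
  proof (intro conjI allI impI)
    fix a b c assume "(\<exists>k. \<eta> a = Some k \<and> \<theta> k = Some b) \<and> c \<in> arrows C \<and> cdom C a = ccod C c"
    then obtain k where k: "\<eta> a = Some k" "\<theta> k = Some b" and c: "c \<in> arrows C" "cdom C a = ccod C c"
      by blast
    have "\<eta> (a \<bullet> c) = Some (k \<bullet> c)" "\<theta> (k \<bullet> c) = Some (b \<bullet> c)"
      using ideal_embeddingD[OF e(1) k(1)] ideal_embeddingD[OF t(1) k(2)] c by simp_all
    then show "\<exists>k. \<eta> (a \<bullet> c) = Some k \<and> \<theta> k = Some (b \<bullet> c)" by blast
  next
    fix a a' b assume "(\<exists>k. \<eta> a = Some k \<and> \<theta> k = Some b) \<and> (\<exists>k. \<eta> a' = Some k \<and> \<theta> k = Some b)"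
    then show "a = a'"
      using ideal_embeddingD(5)[OF t(1)] ideal_embeddingD(5)[OF e(1)] by blast
  qed (use ideal_embeddingD(3)[OF t(1)] ideal_embeddingD(3)[OF e(1)] in
      \<open>auto dest: ideal_embeddingD(1,2)[OF t(1)] ideal_embeddingD(1,2)[OF e(1)]\<close>)
  have c: "ideal_embedding (converse_map \<eta>)" "dom (converse_map \<eta>) = ran \<eta>"
    using converse_in_R[OF \<eta>] R_carrier_iff
    unfolding dom_def ran_def not_None_eq converse_map_Some[OF e(1)] by blast+
  have "dom (\<theta> \<circ>\<^sub>m \<eta>) = {a. \<exists>b\<in>dom \<theta> \<inter> ran \<eta>. converse_map \<eta> b = Some a}"
    unfolding converse_map_Some[OF e(1)]
    by (auto simp: dom_def map_comp_Some_iff ran_def)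
  moreover have "fin_gen {a. \<exists>b\<in>dom \<theta> \<inter> ran \<eta>. converse_map \<eta> b = Some a}"
    using fin_gen_image[OF c(1)] c(2) fin_gen_Int[OF fa t(2) fin_gen_ran[OF e]] by blast
  ultimately show ?thesis using emb R_carrier_iff by simp
qed

lemma fin_gen_all:
  assumes "finite (idents C)"
  shows "fin_gen (arrows C)"
proof -
  have "arrows C = generated C (idents C)"
  proof (intro subset_antisym subsetI)
    fix a assume a: "a \<in> arrows C"
    show "a \<in> generated C (idents C)"
      unfolding generated_iff using principal_ident[OF a] cod_ident[OF a] by blast
  qed (use generated_arrows[OF idents_subset] in blast)
  then show ?thesis using fin_gen_generated[OF idents_subset assms] by simp
qed

lemma R_partial_bijection_rep:
  assumes "finitely_aligned C" "finite (idents C)"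
  shows "partial_bijection_rep (R_monoid C) (\<lambda>\<theta>. \<theta>) (arrows C)"
proof
  show "\<one>\<^bsub>R_monoid C\<^esub> \<in> carrier (R_monoid C)"
    using identity_in_R fin_gen_all assms by (simp add: R_one)
  fix \<theta> assume \<theta>: "\<theta> \<in> carrier (R_monoid C)"
  then have emb: "ideal_embedding \<theta>" by (simp add: R_carrier_iff)
  show "\<exists>\<eta>\<in>carrier (R_monoid C). \<forall>x y. \<eta> y = Some x \<longleftrightarrow> \<theta> x = Some y"
    using converse_in_R[OF \<theta>] converse_map_Some[OF emb] by blast
  show "x \<in> arrows C" if "\<theta> x = Some y" for x y
    using ideal_embeddingD(1)[OF emb that] .
qed (use comp_in_R[OF assms(1)] empty_in_R in \<open>auto simp: R_one R_mult\<close>)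

end


section \<open>Unique factorization and infinite paths\<close>

context higher_rank_graph
begin

lemma factor:
  assumes "a \<in> arrows C" "deg a = m + n"
  obtains p q where "composable p q" "a = p \<bullet> q" "deg p = m" "deg q = n"
  using unique_factorization[OF assms] by blast

lemma factor_unique:
  assumes pq: "composable p q" and pq': "composable p' q'" and eq: "p \<bullet> q = p' \<bullet> q'"
    and deg: "deg p = deg p'"
  shows "p = p' \<and> q = q'"
proof -
  have a: "p \<bullet> q \<in> arrows C" "deg (p \<bullet> q) = deg p + deg q" "deg (p \<bullet> q) = deg p' + deg q'"
    using pq pq' eq comp_closed[of p q] deg_comp[of p q] deg_comp[of p' q'] by metis+
  have q: "deg q' = deg q" using a deg by (metis add_left_imp_eq)
  let ?P = "\<lambda>(a1, a2). a1 \<in> arrows C \<and> a2 \<in> arrows C \<and> cdom C a1 = ccod C a2 \<and>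
    p \<bullet> q = a1 \<bullet> a2 \<and> deg a1 = deg p \<and> deg a2 = deg q"
  have "?P (p, q)" "?P (p', q')" unfolding prod.case using pq pq' eq deg q by (intro conjI; metis)+
  moreover obtain z where "\<forall>y. ?P y \<longrightarrow> y = z"
    using unique_factorization[OF a(1,2)] by (rule ex1E)
  ultimately have "(p, q) = z" "(p', q') = z" by blast+
  then show ?thesis by auto
qed

lemma left_cancel: "\<lbrakk>composable p q; composable p q'; p \<bullet> q = p \<bullet> q'\<rbrakk> \<Longrightarrow> q = q'"
  using factor_unique[of p q p q'] by blast

text \<open>
  Equality of the degrees of \<open>p\<close> and \<open>p'\<close> follows by cancellation, and then uniqueness of factorizations
  applies.
\<close>

lemma right_cancel:
  assumes pq: "composable p q" and pq': "composable p' q" and eq: "p \<bullet> q = p' \<bullet> q"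
  shows "p = p'"
proof -
  have "deg p + deg q = deg p' + deg q"
    using deg_comp[of p q] deg_comp[of p' q] pq pq' eq by metis
  then show ?thesis using factor_unique[OF pq pq' eq] by simp
qed

text \<open>
  Prefixes of one arrow are comparable as soon as their degrees are; the shorter one is
  the unique factor of its degree.
\<close>

lemma prefix_of_prefix:
  assumes x: "x \<in> principal C p" "x \<in> principal C q" and pq: "p \<in> arrows C" "q \<in> arrows C"
    and deg: "deg p = deg q + n"
  shows "p \<in> principal C q"
proof -
  obtain c where c: "composable p c" "x = p \<bullet> c" by (rule principalE[OF x(1) pq(1)])
  obtain d where d: "composable q d" "x = q \<bullet> d" by (rule principalE[OF x(2) pq(2)])
  obtain q' e where e: "composable q' e" "p = q' \<bullet> e" "deg q' = deg q"
    by (rule factor[OF pq(1) deg]) blast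
  have "composable e c \<and> composable q' (e \<bullet> c) \<and> x = q' \<bullet> (e \<bullet> c)"
    using composable_assoc[OF e(1) c(1)[unfolded e(2)]] c(2)[unfolded e(2)] by metis
  then have "q' = q" using factor_unique[of q' "e \<bullet> c" q d] d e(3) by metis
  then show ?thesis using e principalI by metis
qed

lemma prefix_unique:
  assumes x: "x \<in> principal C p" "x \<in> principal C q" and pq: "p \<in> arrows C" "q \<in> arrows C"
    and deg: "deg p = deg q"
  shows "p = q"
proof -
  obtain c where c: "composable p c" "x = p \<bullet> c" by (rule principalE[OF x(1) pq(1)])
  obtain d where d: "composable q d" "x = q \<bullet> d" by (rule principalE[OF x(2) pq(2)])
  show ?thesis using factor_unique[OF c(1) d(1) _ deg] c(2) d(2) by simp
qed

lemma ex_prefix: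
  assumes "x \<in> arrows C" "deg x = m + n"
  shows "\<exists>p\<in>arrows C. x \<in> principal C p \<and> deg p = m"
  using factor[OF assms] principalI by metis

text \<open>
  An infinite path of the higher rank graph, represented by the set of its finite initial
  segments.
\<close>

definition path :: "'a set \<Rightarrow> bool" where
  "path \<omega> \<longleftrightarrow> \<omega> \<subseteq> arrows C \<and> (\<forall>m. \<exists>!a. a \<in> \<omega> \<and> deg a = m) \<and>
     (\<forall>p\<in>arrows C. \<forall>a\<in>\<omega>. a \<in> principal C p \<longrightarrow> p \<in> \<omega>)"

lemma path_arrow: "path \<omega> \<Longrightarrow> a \<in> \<omega> \<Longrightarrow> a \<in> arrows C"
  by (auto simp: path_def)

lemma path_ex: "path \<omega> \<Longrightarrow> \<exists>a\<in>\<omega>. deg a = m"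
  by (auto simp: path_def Ex1_def)

lemma path_unique: "path \<omega> \<Longrightarrow> a \<in> \<omega> \<Longrightarrow> b \<in> \<omega> \<Longrightarrow> deg a = deg b \<Longrightarrow> a = b"
  unfolding path_def by metis

lemma path_prefix: "path \<omega> \<Longrightarrow> a \<in> \<omega> \<Longrightarrow> a \<in> principal C p \<Longrightarrow> p \<in> arrows C \<Longrightarrow> p \<in> \<omega>"
  by (auto simp: path_def)

lemma path_prefix_comp: "path \<omega> \<Longrightarrow> p \<bullet> c \<in> \<omega> \<Longrightarrow> composable p c \<Longrightarrow> p \<in> \<omega>"
  using path_prefix principalI by blast

text \<open>
  Within a path, comparability of degrees is comparability of arrows.
\<close>

lemma path_longer:
  assumes "path \<omega>" "a \<in> \<omega>" "b \<in> \<omega>" "deg b = deg a + n"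
  shows "b \<in> principal C a"
proof -
  obtain p q where pq: "composable p q" "b = p \<bullet> q" "deg p = deg a"
    by (rule factor[OF path_arrow[OF assms(1,3)] assms(4)]) blast
  then have "p \<in> \<omega>" using path_prefix_comp assms by blast
  then have "p = a" using path_unique assms pq by blast
  then show ?thesis using pq principalI by blast
qed

lemma path_directed:
  assumes "path \<omega>" "a \<in> \<omega>" "b \<in> \<omega>"
  obtains c d where "composable a c" "composable b d" "a \<bullet> c = b \<bullet> d" "a \<bullet> c \<in> \<omega>"
proof -
  obtain x where x: "x \<in> \<omega>" "deg x = deg a + deg b" using path_ex assms by blast
  have "x \<in> principal C a" "x \<in> principal C b"
    using path_longer[of \<omega> a x "deg b"] path_longer[of \<omega> b x "deg a"] assms x by (auto simp: add.commute)
  then obtain c d where "composable a c" "x = a \<bullet> c" "composable b d" "x = b \<bullet> d"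
    using principalE[of x] path_arrow[OF assms(1)] assms(2,3) by metis
  then show ?thesis using that x by blast
qed

lemma path_extend:
  assumes "path \<omega>" "a \<in> \<omega>"
  obtains c where "composable a c" "a \<bullet> c \<in> \<omega>" "deg c = m"
proof -
  obtain x where x: "x \<in> \<omega>" "deg x = deg a + m" using path_ex assms by blast
  have a: "a \<in> arrows C" using path_arrow assms by blast
  obtain c where c: "composable a c" "x = a \<bullet> c"
    by (rule principalE[OF path_longer[OF assms x] a])
  then have "deg c = m" using deg_comp[of a c] x by simp
  then show ?thesis using that c x by blast
qed

lemma path_eqI:
  assumes "path \<omega>" "path \<omega>'" "\<omega> \<subseteq> \<omega>'"
  shows "\<omega> = \<omega>'"
proof
  show "\<omega>' \<subseteq> \<omega>"
  proof
    fix a assume a: "a \<in> \<omega>'"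
    obtain b where b: "b \<in> \<omega>" "deg b = deg a" using path_ex assms(1) by blast
    then have "b = a" using path_unique[OF assms(2), of b a] assms a by blast
    then show "a \<in> \<omega>" using b by simp
  qed
qed fact

text \<open>
  The diagonal is cofinal in \<open>nat ^ 'k\<close>; this lets a sequence of arrows exhaust all degrees.
\<close>

lemma vec_plus_constant: "\<exists>N. \<exists>p::nat ^ 'k. m + p = (\<chi> i. N)"
proof -
  have le: "m $ i \<le> (\<Sum>j\<in>UNIV. m $ j)" for i by (rule member_le_sum) auto
  have "m + (\<chi> i. (\<Sum>j\<in>UNIV. m $ j) - m $ i) = (\<chi> i. \<Sum>j\<in>UNIV. m $ j)"
    using le by (simp add: vec_eq_iff)
  then show ?thesis by blast
qed

lemma path_of_chain:
  assumes f: "\<And>n. f n \<in> arrows C" and chain: "\<And>n. f (Suc n) \<in> principal C (f n)"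
    and cofinal: "\<And>m. \<exists>n p. deg (f n) = m + p"
  shows "path {p \<in> arrows C. \<exists>n. f n \<in> principal C p}" (is "path ?w")
proof -
  have mono: "f (n + k) \<in> principal C (f n)" for n k
  proof (induction k)
    case 0 show ?case using principal_self f by simp
  next
    case (Suc k) then show ?case using principal_trans[OF chain[of "n + k"]] f by simp
  qed
  have uniq: "p = q" if pq: "p \<in> ?w" "q \<in> ?w" "deg p = deg q" for p q
  proof -
    obtain i j where ij: "f i \<in> principal C p" "f j \<in> principal C q" using pq by blast
    have "f (i + j) \<in> principal C p" "f (i + j) \<in> principal C q"
      using principal_trans[OF mono[of i j] ij(1)] principal_trans[OF mono[of j i] ij(2)] that
      by (auto simp: add.commute)
    then show ?thesis using prefix_unique that by blast
  qed
  have "\<exists>!a. a \<in> ?w \<and> deg a = m" for m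
  proof -
    obtain n p where "deg (f n) = m + p" using cofinal by blast
    then obtain a where "a \<in> arrows C" "f n \<in> principal C a" "deg a = m" using ex_prefix f by blast
    then show ?thesis using uniq by blast
  qed
  moreover have "p \<in> ?w" if "p \<in> arrows C" "a \<in> ?w" "a \<in> principal C p" for p a
    using that principal_trans by blast
  ultimately show ?thesis unfolding path_def by blast
qed

text \<open>
  Without sources, an arrow can be extended again and again by arrows of degree \<open>(1, \<dots>, 1)\<close>; the
  prefixes of the extensions form a path.
\<close>

lemma path_through:
  assumes ns: "no_sources C deg" and a: "a \<in> arrows C"
  obtains \<omega> where "path \<omega>" "a \<in> \<omega>"
proof -
  define ext where "ext b = (SOME c. c \<in> arrows C \<and> ccod C c = cdom C b \<and> deg c = (\<chi> i. 1))" for b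
  have ext: "composable b (ext b) \<and> deg (ext b) = (\<chi> i. 1)" if "b \<in> arrows C" for b
  proof -
    have "\<exists>c. c \<in> arrows C \<and> ccod C c = cdom C b \<and> deg c = (\<chi> i. 1)"
      using ns dom_ident[OF that] unfolding no_sources_def by blast
    from someI_ex[OF this] show ?thesis using that unfolding ext_def by simp
  qed
  define f where "f = rec_nat a (\<lambda>_ b. b \<bullet> ext b)"
  have f0: "f 0 = a" and fS: "f (Suc n) = f n \<bullet> ext (f n)" for n by (simp_all add: f_def)
  have f: "f n \<in> arrows C" for n
  proof (induction n)
    case 0 show ?case using a f0 by simp
  next
    case (Suc n) show ?case using ext[OF Suc] comp_closed[of "f n" "ext (f n)"] fS by simp
  qed
  have deg_f: "deg (f n) = deg a + (\<chi> i. n)" for n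
  proof (induction n)
    case 0 show ?case by (simp add: f0 vec_eq_iff)
  next
    case (Suc n)
    have "deg (f (Suc n)) = deg (f n) + deg (ext (f n))"
      using deg_comp[of "f n" "ext (f n)"] ext[OF f[of n]] fS by simp
    then show ?case using Suc ext[OF f[of n]] by (simp add: vec_eq_iff)
  qed
  have "path {p \<in> arrows C. \<exists>n. f n \<in> principal C p}"
  proof (rule path_of_chain)
    show "f (Suc n) \<in> principal C (f n)" for n
      unfolding fS by (rule principalI) (use ext[OF f] in blast)
    fix m :: "nat ^ 'k"
    obtain N p where Np: "m + p = (\<chi> i. N)" using vec_plus_constant by blast
    then have "deg (f N) = m + (p + deg a)" by (simp add: deg_f add_ac flip: Np)
    then show "\<exists>n p. deg (f n) = m + p" by blast
  qed (rule f)
  moreover have "a \<in> {p \<in> arrows C. \<exists>n. f n \<in> principal C p}"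
    using f0 a principal_self by (intro CollectI conjI exI[of _ 0]) simp_all
  ultimately show ?thesis using that by blast
qed

text \<open>
  \<open>\<omega>'\<close> arises from \<open>\<omega>\<close> by replacing the initial segment \<open>a\<close> by \<open>b\<close>.  The symmetric formulation makes
  inversion and composition of the action immediate.
\<close>

definition linked :: "'a set \<Rightarrow> 'a \<Rightarrow> 'a set \<Rightarrow> 'a \<Rightarrow> bool" where
  "linked \<omega> a \<omega>' b \<longleftrightarrow> path \<omega> \<and> path \<omega>' \<and> a \<in> \<omega> \<and> b \<in> \<omega>' \<and> cdom C a = cdom C b \<and>
     (\<forall>c\<in>arrows C. ccod C c = cdom C a \<longrightarrow> (a \<bullet> c \<in> \<omega> \<longleftrightarrow> b \<bullet> c \<in> \<omega>'))"

lemma linked_sym: "linked \<omega> a \<omega>' b \<Longrightarrow> linked \<omega>' b \<omega> a"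
  by (auto simp: linked_def)

lemma linked_refl: "path \<omega> \<Longrightarrow> a \<in> \<omega> \<Longrightarrow> linked \<omega> a \<omega> a"
  by (auto simp: linked_def)

lemma linked_trans: "linked \<omega> a \<omega>' b \<Longrightarrow> linked \<omega>' b \<omega>'' d \<Longrightarrow> linked \<omega> a \<omega>'' d"
  by (auto simp: linked_def)

lemma linked_extend:
  assumes l: "linked \<omega> a \<omega>' b" and c: "composable a c" "a \<bullet> c \<in> \<omega>"
  shows "linked \<omega> (a \<bullet> c) \<omega>' (b \<bullet> c)"
proof -
  have b: "composable b c" using l c path_arrow unfolding linked_def by metis
  have "cdom C (a \<bullet> c) = cdom C c" "cdom C (b \<bullet> c) = cdom C c"
    using dom_comp b c by blast+
  moreover have "(a \<bullet> c) \<bullet> d \<in> \<omega> \<longleftrightarrow> (b \<bullet> c) \<bullet> d \<in> \<omega>'" if "d \<in> arrows C" "ccod C d = cdom C c" for d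
  proof -
    have "(a \<bullet> c) \<bullet> d = a \<bullet> (c \<bullet> d)" "(b \<bullet> c) \<bullet> d = b \<bullet> (c \<bullet> d)" "c \<bullet> d \<in> arrows C" "ccod C (c \<bullet> d) = cdom C a"
      using composable_assoc'[of a c d] composable_assoc'[of b c d] b c that by auto
    then show ?thesis using l unfolding linked_def by simp
  qed
  ultimately show ?thesis using l c b unfolding linked_def by simp
qed

text \<open>
  The extensions of \<open>b\<close> are cofinal in the path \<open>\<omega>'\<close>, so \<open>\<omega>'\<close> is determined by them, and they are
  prescribed by \<open>\<omega>\<close>.
\<close>

lemma linked_unique:
  assumes l: "linked \<omega> a \<omega>' b" and l': "linked \<omega> a \<omega>'' b"
  shows "\<omega>' = \<omega>''"
proof (rule path_eqI)
  show "path \<omega>'" "path \<omega>''" using l l' by (auto simp: linked_def)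
  show "\<omega>' \<subseteq> \<omega>''"
  proof
    fix p assume p: "p \<in> \<omega>'"
    have "path \<omega>'" "b \<in> \<omega>'" using l by (auto simp: linked_def)
    then obtain c d where cd: "composable b c" "composable p d" "b \<bullet> c = p \<bullet> d" "b \<bullet> c \<in> \<omega>'"
      using p by (rule path_directed)
    have "c \<in> arrows C" "ccod C c = cdom C a" using l cd by (auto simp: linked_def)
    then have "b \<bullet> c \<in> \<omega>''" using l l' cd unfolding linked_def by blast
    then show "p \<in> \<omega>''" using cd path_prefix_comp[of \<omega>'' p d] l' unfolding linked_def by simp
  qed
qed

text \<open>
  The new path consists of all prefixes of arrows \<open>b \<bullet> c\<close> with \<open>a \<bullet> c \<in> \<omega>\<close>.  These arrows are directed,
  because the extensions of \<open>a\<close> in \<open>\<omega>\<close> are and \<open>a\<close> can be cancelled on the left.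
\<close>

lemma linked_ex:
  assumes w: "path \<omega>" "a \<in> \<omega>" and b: "b \<in> arrows C" "cdom C b = cdom C a"
  obtains \<omega>' where "linked \<omega> a \<omega>' b"
proof -
  have a: "a \<in> arrows C" using path_arrow w by blast
  let ?w = "{p \<in> arrows C. \<exists>c. composable a c \<and> a \<bullet> c \<in> \<omega> \<and> b \<bullet> c \<in> principal C p}"
  have uniq: "p = q" if pq: "p \<in> ?w" "q \<in> ?w" "deg p = deg q" for p q
  proof -
    obtain c d where cd: "composable a c" "a \<bullet> c \<in> \<omega>" "b \<bullet> c \<in> principal C p"
      "composable a d" "a \<bullet> d \<in> \<omega>" "b \<bullet> d \<in> principal C q" and p: "p \<in> arrows C" "q \<in> arrows C"
      using pq(1,2) by blast
    obtain c' d' where e: "composable (a \<bullet> c) c'" "composable (a \<bullet> d) d'" "(a \<bullet> c) \<bullet> c' = (a \<bullet> d) \<bullet> d'"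
      by (rule path_directed[OF w(1) cd(2) cd(5)])
    have 1: "composable c c'" "composable a (c \<bullet> c')" "(a \<bullet> c) \<bullet> c' = a \<bullet> (c \<bullet> c')"
      using composable_assoc[OF cd(1) e(1)] by blast+
    have 2: "composable d d'" "composable a (d \<bullet> d')" "(a \<bullet> d) \<bullet> d' = a \<bullet> (d \<bullet> d')"
      using composable_assoc[OF cd(4) e(2)] by blast+
    have eq: "c \<bullet> c' = d \<bullet> d'" using left_cancel[OF 1(2) 2(2)] 1 2 e by simp
    have bc: "composable b c" "composable b d" using cd b by simp_all
    have "b \<bullet> (c \<bullet> c') \<in> principal C p"
      using composable_assoc'[OF bc(1) 1(1)] principal_trans[OF principalI cd(3) p(1), of c'] by simp
    moreover have "b \<bullet> (d \<bullet> d') \<in> principal C q"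
      using composable_assoc'[OF bc(2) 2(1)] principal_trans[OF principalI cd(6) p(2), of d'] by simp
    ultimately show ?thesis using eq prefix_unique that p by simp
  qed
  have "\<exists>!p. p \<in> ?w \<and> deg p = m" for m
  proof -
    obtain c where c: "composable a c" "a \<bullet> c \<in> \<omega>" "deg c = m"
      by (rule path_extend[OF w])
    have bc: "composable b c" using c b by simp
    have "b \<bullet> c \<in> arrows C" "deg (b \<bullet> c) = m + deg b"
      using comp_closed[of b c] deg_comp[of b c] bc c by (auto simp: add.commute)
    then obtain p where "p \<in> arrows C" "b \<bullet> c \<in> principal C p" "deg p = m"
      using ex_prefix by blast
    then show ?thesis using uniq c by blast
  qed
  moreover have "p \<in> ?w" if "p \<in> arrows C" "q \<in> ?w" "q \<in> principal C p" for p q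
    using that principal_trans by blast
  ultimately have path: "path ?w" unfolding path_def by blast
  have fwd: "b \<bullet> c \<in> ?w" if c: "composable a c" "a \<bullet> c \<in> \<omega>" for c
    using that b comp_closed[of b c] principal_self[of "b \<bullet> c"] by auto
  have bwd: "a \<bullet> c \<in> \<omega>" if c: "composable a c" "b \<bullet> c \<in> ?w" for c
  proof -
    obtain d where d: "composable a d" "a \<bullet> d \<in> \<omega>" "b \<bullet> d \<in> principal C (b \<bullet> c)" and bc: "b \<bullet> c \<in> arrows C"
      using c(2) by blast
    obtain e where e: "composable (b \<bullet> c) e" "b \<bullet> d = (b \<bullet> c) \<bullet> e" by (rule principalE[OF d(3) bc])
    have bc: "composable b c" "composable b d" using c d b by simp_all
    have ce: "composable c e" "composable b (c \<bullet> e)" "b \<bullet> d = b \<bullet> (c \<bullet> e)"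
      using composable_assoc[OF bc(1) e(1)] e by simp_all
    have "d = c \<bullet> e" using left_cancel[OF bc(2) ce(2,3)] .
    then have "(a \<bullet> c) \<bullet> e \<in> \<omega>" "composable (a \<bullet> c) e" using composable_assoc'[OF c(1) ce(1)] d by simp_all
    then show ?thesis using path_prefix_comp w by blast
  qed
  have bw: "b \<in> ?w" using fwd[of "cdom C a"] composable_dom[OF a] comp_dom[OF a] comp_dom[OF b(1)] w(2) b(2) by simp
  have "a \<bullet> c \<in> \<omega> \<longleftrightarrow> b \<bullet> c \<in> ?w" if "c \<in> arrows C" "ccod C c = cdom C a" for c
  proof
    have c: "composable a c" using that a by simp
    show "b \<bullet> c \<in> ?w" if "a \<bullet> c \<in> \<omega>" by (rule fwd[OF c that])
    show "a \<bullet> c \<in> \<omega>" if "b \<bullet> c \<in> ?w" by (rule bwd[OF c that])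
  qed
  then have "linked \<omega> a ?w b"
    unfolding linked_def by (intro conjI ballI impI w path bw b(2)[symmetric])
  then show ?thesis using that by blast
qed

end


section \<open>The action of \<open>R(C)\<close> on graded infinite paths\<close>

locale row_finite_graph = higher_rank_graph C deg
  for C :: "'a category" (structure) and deg :: "'a \<Rightarrow> nat ^ 'k" +
  assumes aligned: "finitely_aligned C"
    and finite_idents: "finite (idents C)"
    and sourceless: "no_sources C deg"
    and rows_finite: "row_finite C deg"
begin

sublocale R: partial_bijection_rep "R_monoid C" "\<lambda>\<theta>. \<theta>" "arrows C"
  by (rule R_partial_bijection_rep[OF aligned finite_idents])

abbreviation R_elements :: "('a \<rightharpoonup> 'a) set" (\<open>\<R>\<close>) where
  "\<R> \<equiv> carrier (R_monoid C)"

lemma R_embedding: "\<theta> \<in> \<R> \<Longrightarrow> ideal_embedding \<theta>" and R_dom: "\<theta> \<in> \<R> \<Longrightarrow> fin_gen (dom \<theta>)"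
  by (simp_all add: R_carrier_iff)

lemma R_D:
  assumes "\<theta> \<in> \<R>" "\<theta> a = Some b"
  shows "a \<in> arrows C" "b \<in> arrows C" "cdom C b = cdom C a"
    and "composable a c \<Longrightarrow> \<theta> (a \<bullet> c) = Some (b \<bullet> c)"
    and "\<theta> a' = Some b \<Longrightarrow> a' = a"
  using ideal_embeddingD[OF R_embedding[OF assms(1)] assms(2)] by blast+

text \<open>
  \<open>germ \<theta> a b \<omega> z \<omega>' z'\<close> says that \<open>\<theta>\<close> carries the graded path \<open>(\<omega>, z)\<close> to \<open>(\<omega>', z')\<close> and that this is
  witnessed by the initial segment \<open>a\<close>, which \<open>\<theta>\<close> maps to \<open>b\<close>.  The grade is a vector of integers, since
  degrees may drop; the condition on it is \<open>z' = z + deg b - deg a\<close>.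
\<close>

definition germ :: "('a \<rightharpoonup> 'a) \<Rightarrow> 'a \<Rightarrow> 'a \<Rightarrow> 'a set \<Rightarrow> ('k \<Rightarrow> int) \<Rightarrow> 'a set \<Rightarrow> ('k \<Rightarrow> int) \<Rightarrow> bool" where
  "germ \<theta> a b \<omega> z \<omega>' z' \<longleftrightarrow> \<theta> a = Some b \<and> linked \<omega> a \<omega>' b \<and>
     (\<forall>i. z' i + int (deg a $ i) = z i + int (deg b $ i))"

definition moves :: "('a \<rightharpoonup> 'a) \<Rightarrow> 'a set \<Rightarrow> ('k \<Rightarrow> int) \<Rightarrow> 'a set \<Rightarrow> ('k \<Rightarrow> int) \<Rightarrow> bool" where
  "moves \<theta> \<omega> z \<omega>' z' \<longleftrightarrow> (\<exists>a b. germ \<theta> a b \<omega> z \<omega>' z')"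

lemma germ_paths:
  assumes "germ \<theta> a b \<omega> z \<omega>' z'"
  shows "path \<omega>" "path \<omega>'" "a \<in> \<omega>" "b \<in> \<omega>'" "cdom C a = cdom C b" "\<theta> a = Some b"
  using assms by (auto simp: germ_def linked_def)

lemma germ_extend:
  assumes \<theta>: "\<theta> \<in> \<R>" and g: "germ \<theta> a b \<omega> z \<omega>' z'" and c: "composable a c" "a \<bullet> c \<in> \<omega>"
  shows "germ \<theta> (a \<bullet> c) (b \<bullet> c) \<omega> z \<omega>' z'"
proof -
  have ab: "\<theta> a = Some b" and l: "linked \<omega> a \<omega>' b" and
    z: "\<And>i. z' i + int (deg a $ i) = z i + int (deg b $ i)" using g by (auto simp: germ_def)
  have bc: "composable b c" using R_D(2,3)[OF \<theta> ab] c by simp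
  have "deg (a \<bullet> c) = deg a + deg c" "deg (b \<bullet> c) = deg b + deg c"
    using deg_comp c(1) bc by blast+
  then have "z' i + int (deg (a \<bullet> c) $ i) = z i + int (deg (b \<bullet> c) $ i)" for i
    using z[of i] by simp
  then show ?thesis
    unfolding germ_def using R_D(4)[OF \<theta> ab c(1)] linked_extend[OF l c] by blast
qed

lemma germ_ex:
  assumes "\<theta> \<in> \<R>" "\<theta> a = Some b" "path \<omega>" "a \<in> \<omega>"
  obtains \<omega>' z' where "germ \<theta> a b \<omega> z \<omega>' z'"
proof -
  obtain \<omega>' where "linked \<omega> a \<omega>' b"
    by (rule linked_ex[OF assms(3,4) R_D(2,3)[OF assms(1,2)]])
  then have "germ \<theta> a b \<omega> z \<omega>' (\<lambda>i. z i + int (deg b $ i) - int (deg a $ i))"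
    using assms(2) by (simp add: germ_def)
  then show ?thesis using that by blast
qed

text \<open>
  This is the purpose of the grade: it fixes \<open>deg b\<close>, and a path has only one arrow of that degree.
\<close>

lemma germ_value_unique:
  assumes "germ \<theta> a b \<omega> z \<omega>' z'" "germ \<eta> a b' \<omega> z \<omega>' z'"
  shows "b = b'"
proof -
  have "int (deg b $ i) = int (deg b' $ i)" for i
    using assms unfolding germ_def by (metis add_left_cancel)
  then have "deg b = deg b'" by (simp add: vec_eq_iff)
  then show ?thesis using path_unique germ_paths[OF assms(1)] germ_paths[OF assms(2)] by blast
qed

lemma germ_target_unique:
  assumes "germ \<theta> a b \<omega> z \<omega>1 z1" "germ \<eta> a b \<omega> z \<omega>2 z2"
  shows "\<omega>1 = \<omega>2 \<and> z1 = z2"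
proof
  show "\<omega>1 = \<omega>2" using assms linked_unique unfolding germ_def by blast
  show "z1 = z2"
  proof
    fix i show "z1 i = z2 i" using assms unfolding germ_def by (metis add_right_cancel)
  qed
qed

text \<open>
  Witnesses can be lengthened, and a path is directed; so two germs at the same graded path have
  witnesses with the same initial segment.
\<close>

lemma common_germs:
  assumes \<theta>: "\<theta> \<in> \<R>" and \<eta>: "\<eta> \<in> \<R>"
    and g: "germ \<theta> a b \<omega> z \<omega>1 z1" and h: "germ \<eta> a' b' \<omega> z \<omega>2 z2"
  obtains x u v where "x \<in> principal C a" "x \<in> principal C a'" "germ \<theta> x u \<omega> z \<omega>1 z1" "germ \<eta> x v \<omega> z \<omega>2 z2"
proof -
  obtain c d where cd: "composable a c" "composable a' d" "a \<bullet> c = a' \<bullet> d" "a \<bullet> c \<in> \<omega>"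
    by (rule path_directed[OF germ_paths(1,3)[OF g] germ_paths(3)[OF h]])
  have "germ \<theta> (a \<bullet> c) (b \<bullet> c) \<omega> z \<omega>1 z1" by (rule germ_extend[OF \<theta> g cd(1,4)])
  moreover have "germ \<eta> (a \<bullet> c) (b' \<bullet> d) \<omega> z \<omega>2 z2"
    unfolding cd(3) by (rule germ_extend[OF \<eta> h cd(2) cd(4)[unfolded cd(3)]])
  ultimately show ?thesis using that principalI[OF cd(1)] principalI[OF cd(2)] cd(3) by metis
qed

lemma moves_functional:
  assumes \<theta>: "\<theta> \<in> \<R>" and m: "moves \<theta> \<omega> z \<omega>1 z1" "moves \<theta> \<omega> z \<omega>2 z2"
  shows "\<omega>1 = \<omega>2 \<and> z1 = z2"
proof -
  obtain a b a' b' where g: "germ \<theta> a b \<omega> z \<omega>1 z1" "germ \<theta> a' b' \<omega> z \<omega>2 z2"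
    using m unfolding moves_def by blast
  obtain x u v where x: "germ \<theta> x u \<omega> z \<omega>1 z1" "germ \<theta> x v \<omega> z \<omega>2 z2"
    by (rule common_germs[OF \<theta> \<theta> g])
  then have "u = v" using germ_paths(6)[OF x(1)] germ_paths(6)[OF x(2)] by simp
  then show ?thesis using germ_target_unique x by blast
qed

lemma moves_dom:
  assumes "\<theta> \<in> \<R>"
  shows "(\<exists>\<omega>' z'. moves \<theta> \<omega> z \<omega>' z') \<longleftrightarrow> path \<omega> \<and> \<omega> \<inter> dom \<theta> \<noteq> {}"
proof
  assume "\<exists>\<omega>' z'. moves \<theta> \<omega> z \<omega>' z'"
  then obtain a b \<omega>' z' where g: "germ \<theta> a b \<omega> z \<omega>' z'" unfolding moves_def by blast
  show "path \<omega> \<and> \<omega> \<inter> dom \<theta> \<noteq> {}"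
    using germ_paths(1,3,6)[OF g] by blast
next
  assume "path \<omega> \<and> \<omega> \<inter> dom \<theta> \<noteq> {}"
  then obtain a b where ab: "path \<omega>" "a \<in> \<omega>" "\<theta> a = Some b" by blast
  obtain \<omega>' z' where "germ \<theta> a b \<omega> z \<omega>' z'" by (rule germ_ex[OF assms ab(3,1,2)])
  then show "\<exists>\<omega>' z'. moves \<theta> \<omega> z \<omega>' z'" unfolding moves_def by blast
qed

lemma germ_converse:
  assumes "\<theta> \<in> \<R>"
  shows "germ (converse_map \<theta>) b a \<omega>' z' \<omega> z \<longleftrightarrow> germ \<theta> a b \<omega> z \<omega>' z'"
  unfolding germ_def converse_map_Some[OF R_embedding[OF assms]] using linked_sym by metis

lemma moves_converse:
  "\<theta> \<in> \<R> \<Longrightarrow> moves (converse_map \<theta>) \<omega>' z' \<omega> z \<longleftrightarrow> moves \<theta> \<omega> z \<omega>' z'"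
  unfolding moves_def germ_converse by blast

text \<open>
  From left to right the intermediate path is obtained by performing \<open>\<eta>\<close> on the witness.  From right to
  left the two witnesses on the intermediate path are first made equal, by viewing the first
  step through the converse of \<open>\<eta>\<close>.
\<close>

lemma moves_comp:
  assumes \<theta>: "\<theta> \<in> \<R>" and \<eta>: "\<eta> \<in> \<R>"
  shows "moves (\<theta> \<circ>\<^sub>m \<eta>) \<omega> z \<omega>'' z'' \<longleftrightarrow> (\<exists>\<omega>' z'. moves \<eta> \<omega> z \<omega>' z' \<and> moves \<theta> \<omega>' z' \<omega>'' z'')"
proof
  assume "moves (\<theta> \<circ>\<^sub>m \<eta>) \<omega> z \<omega>'' z''"
  then obtain a d where g: "germ (\<theta> \<circ>\<^sub>m \<eta>) a d \<omega> z \<omega>'' z''" unfolding moves_def by blast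
  then obtain b where b: "\<eta> a = Some b" "\<theta> b = Some d"
    by (auto simp: germ_def map_comp_Some_iff)
  obtain \<omega>' z' where g1: "germ \<eta> a b \<omega> z \<omega>' z'"
    by (rule germ_ex[OF \<eta> b(1) germ_paths(1,3)[OF g]])
  have "linked \<omega>' b \<omega>'' d"
    using linked_trans[OF linked_sym[of \<omega> a \<omega>' b]] g g1 unfolding germ_def by blast
  moreover have "z'' i + int (deg b $ i) = z' i + int (deg d $ i)" for i
  proof -
    have "z'' i + int (deg a $ i) = z i + int (deg d $ i)" "z' i + int (deg a $ i) = z i + int (deg b $ i)"
      using g g1 unfolding germ_def by blast+
    then show ?thesis by linarith
  qed
  ultimately have "germ \<theta> b d \<omega>' z' \<omega>'' z''" using b unfolding germ_def by blast
  then show "\<exists>\<omega>' z'. moves \<eta> \<omega> z \<omega>' z' \<and> moves \<theta> \<omega>' z' \<omega>'' z''"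
    using g1 unfolding moves_def by blast
next
  assume "\<exists>\<omega>' z'. moves \<eta> \<omega> z \<omega>' z' \<and> moves \<theta> \<omega>' z' \<omega>'' z''"
  then obtain \<omega>' z' a b b' d where g: "germ \<eta> a b \<omega> z \<omega>' z'" and h: "germ \<theta> b' d \<omega>' z' \<omega>'' z''"
    unfolding moves_def by blast
  note g' = g[folded germ_converse[OF \<eta>]]
  obtain x u v where x: "germ (converse_map \<eta>) x u \<omega>' z' \<omega> z" "germ \<theta> x v \<omega>' z' \<omega>'' z''"
    by (rule common_germs[OF converse_in_R[OF \<eta>] \<theta> g' h])
  have g2: "germ \<eta> u x \<omega> z \<omega>' z'" using x(1) germ_converse[OF \<eta>] by blast
  have "linked \<omega> u \<omega>'' v"
    using linked_trans g2 x(2) unfolding germ_def by blast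
  moreover have "z'' i + int (deg u $ i) = z i + int (deg v $ i)" for i
  proof -
    have "z' i + int (deg u $ i) = z i + int (deg x $ i)" "z'' i + int (deg x $ i) = z' i + int (deg v $ i)"
      using g2 x(2) unfolding germ_def by blast+
    then show ?thesis by linarith
  qed
  moreover have "(\<theta> \<circ>\<^sub>m \<eta>) u = Some v"
    using germ_paths(6)[OF g2] germ_paths(6)[OF x(2)] by simp
  ultimately show "moves (\<theta> \<circ>\<^sub>m \<eta>) \<omega> z \<omega>'' z''" unfolding moves_def germ_def by blast
qed

lemma moves_identity:
  "moves (Some |` D) \<omega> z \<omega>' z' \<longleftrightarrow> path \<omega> \<and> \<omega> \<inter> D \<noteq> {} \<and> \<omega>' = \<omega> \<and> z' = z"
proof
  assume "moves (Some |` D) \<omega> z \<omega>' z'"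
  then obtain a b where g: "germ (Some |` D) a b \<omega> z \<omega>' z'" unfolding moves_def by blast
  then have ab: "a \<in> D" "b = a" by (auto simp: germ_def restrict_Some)
  have "germ (Some |` D) a a \<omega> z \<omega> z"
    using ab linked_refl germ_paths[OF g] by (simp add: germ_def restrict_Some)
  then show "path \<omega> \<and> \<omega> \<inter> D \<noteq> {} \<and> \<omega>' = \<omega> \<and> z' = z"
    using germ_target_unique g ab germ_paths[OF g] by blast
next
  assume a: "path \<omega> \<and> \<omega> \<inter> D \<noteq> {} \<and> \<omega>' = \<omega> \<and> z' = z"
  then obtain a where "a \<in> \<omega>" "a \<in> D" by blast
  then have "germ (Some |` D) a a \<omega> z \<omega>' z'"
    using a linked_refl by (simp add: germ_def restrict_Some)
  then show "moves (Some |` D) \<omega> z \<omega>' z'" unfolding moves_def by blast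
qed

section \<open>Compatible unions and complements\<close>

text \<open>
  Agreement on graded paths is agreement on arrows: choose a path through \<open>a\<close>.
\<close>

lemma common_domain_agree:
  assumes \<theta>: "\<theta> \<in> \<R>" and \<eta>: "\<eta> \<in> \<R>"
    and comp: "\<And>\<omega> z \<omega>1 z1 \<omega>2 z2. moves \<theta> \<omega> z \<omega>1 z1 \<Longrightarrow> moves \<eta> \<omega> z \<omega>2 z2 \<Longrightarrow> \<omega>1 = \<omega>2 \<and> z1 = z2"
    and ab: "\<theta> a = Some b" "\<eta> a = Some b'"
  shows "b = b'"
proof -
  obtain \<omega> where w: "path \<omega>" "a \<in> \<omega>" by (rule path_through[OF sourceless R_D(1)[OF \<theta> ab(1)]])
  obtain \<omega>1 z1 where g: "germ \<theta> a b \<omega> (\<lambda>i. 0) \<omega>1 z1" by (rule germ_ex[OF \<theta> ab(1) w])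
  obtain \<omega>2 z2 where h: "germ \<eta> a b' \<omega> (\<lambda>i. 0) \<omega>2 z2" by (rule germ_ex[OF \<eta> ab(2) w])
  have "\<omega>1 = \<omega>2 \<and> z1 = z2" using comp g h unfolding moves_def by blast
  then show ?thesis using germ_value_unique g h by blast
qed

text \<open>
  Both the functionality of the union and its injectivity come from the preceding lemma, applied to
  the maps and to their converses.
\<close>

lemma compatible_union_in_R:
  assumes \<theta>: "\<theta> \<in> \<R>" and \<eta>: "\<eta> \<in> \<R>"
    and comp: "\<And>\<omega> z \<omega>1 z1 \<omega>2 z2. moves \<theta> \<omega> z \<omega>1 z1 \<Longrightarrow> moves \<eta> \<omega> z \<omega>2 z2 \<Longrightarrow> \<omega>1 = \<omega>2 \<and> z1 = z2"
    and comp': "\<And>\<omega> z \<omega>1 z1 \<omega>2 z2. moves \<theta> \<omega>1 z1 \<omega> z \<Longrightarrow> moves \<eta> \<omega>2 z2 \<omega> z \<Longrightarrow> \<omega>1 = \<omega>2 \<and> z1 = z2"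
  shows "\<theta> ++ \<eta> \<in> \<R> \<and> (\<forall>a b. (\<theta> ++ \<eta>) a = Some b \<longleftrightarrow> \<theta> a = Some b \<or> \<eta> a = Some b)"
proof -
  have agree: "b = b'" if "\<theta> a = Some b" "\<eta> a = Some b'" for a b b'
    using common_domain_agree[OF \<theta> \<eta> comp that] .
  have agree': "a = a'" if "\<theta> a = Some b" "\<eta> a' = Some b" for a a' b
  proof (rule common_domain_agree[OF converse_in_R[OF \<theta>] converse_in_R[OF \<eta>]])
    show "converse_map \<theta> b = Some a" "converse_map \<eta> b = Some a'"
      using that converse_map_Some R_embedding \<theta> \<eta> by blast+
    show "\<omega>1 = \<omega>2 \<and> z1 = z2"
      if "moves (converse_map \<theta>) \<omega> z \<omega>1 z1" "moves (converse_map \<eta>) \<omega> z \<omega>2 z2" for \<omega> z \<omega>1 z1 \<omega>2 z2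
      using that comp' unfolding moves_converse[OF \<theta>] moves_converse[OF \<eta>] by blast
  qed
  have iff: "(\<theta> ++ \<eta>) a = Some b \<longleftrightarrow> \<theta> a = Some b \<or> \<eta> a = Some b" for a b
    unfolding map_add_Some_iff using agree by (cases "\<eta> a") auto
  have "ideal_embedding (\<theta> ++ \<eta>)"
    unfolding ideal_embedding_def iff
  proof (intro conjI allI impI)
    fix a b c assume "(\<theta> a = Some b \<or> \<eta> a = Some b) \<and> c \<in> arrows C \<and> cdom C a = ccod C c"
    then show "\<theta> (a \<bullet> c) = Some (b \<bullet> c) \<or> \<eta> (a \<bullet> c) = Some (b \<bullet> c)"
      using R_D(1,4)[OF \<theta>, of a b] R_D(1,4)[OF \<eta>, of a b] by blast
  next
    fix a a' b assume "(\<theta> a = Some b \<or> \<eta> a = Some b) \<and> (\<theta> a' = Some b \<or> \<eta> a' = Some b)"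
    then show "a = a'"
      using R_D(5)[OF \<theta>] R_D(5)[OF \<eta>] agree' by blast
  qed (use R_D(1-3)[OF \<theta>] R_D(1-3)[OF \<eta>] in blast)+
  moreover have "fin_gen (dom (\<theta> ++ \<eta>))"
    using fin_gen_Un[OF R_dom[OF \<eta>] R_dom[OF \<theta>]] by simp
  ultimately show ?thesis using iff R_carrier_iff by blast
qed

lemma moves_union:
  assumes "\<And>a b. \<zeta> a = Some b \<longleftrightarrow> \<theta> a = Some b \<or> \<eta> a = Some b"
  shows "moves \<zeta> \<omega> z \<omega>' z' \<longleftrightarrow> moves \<theta> \<omega> z \<omega>' z' \<or> moves \<eta> \<omega> z \<omega>' z'"
  unfolding moves_def germ_def assms by blast

text \<open>
  A compactness property of finitely generated ideals: beyond a certain degree, an arrow that has an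
  extension in the ideal lies in the ideal itself.
\<close>

lemma fin_gen_degree_bound:
  assumes "fin_gen D"
  obtains m where "\<And>a n x. a \<in> arrows C \<Longrightarrow> deg a = m + n \<Longrightarrow> x \<in> principal C a \<Longrightarrow> x \<in> D \<Longrightarrow> a \<in> D"
proof -
  obtain X where X: "X \<subseteq> arrows C" "finite X" "D = generated C X" using assms by (auto simp: fin_gen_def)
  show ?thesis
  \<comment> \<open>the sum is a common upper bound for the degrees of the generators\<close>
  proof (rule that[of "\<Sum>x\<in>X. deg x"])
    fix a n y assume a: "a \<in> arrows C" "deg a = (\<Sum>x\<in>X. deg x) + n" "y \<in> principal C a" "y \<in> D"
    then obtain x where x: "x \<in> X" "y \<in> principal C x" using X by (auto simp: generated_iff)
    have "deg a = deg x + ((\<Sum>x\<in>X - {x}. deg x) + n)"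
      using a(2) sum.remove[OF X(2) x(1), of deg] by (simp add: add.assoc)
    then have "a \<in> principal C x" using prefix_of_prefix[OF a(3) x(2) a(1)] x(1) X(1) by blast
    then show "a \<in> D" using x X by (auto simp: generated_iff)
  qed
qed

lemma finite_degree: "finite {a \<in> arrows C. deg a = m}"
proof -
  have "{a \<in> arrows C. deg a = m} \<subseteq> (\<Union>e\<in>idents C. {x \<in> principal C e. deg x = m})"
    using principal_ident cod_ident by blast
  moreover have "finite (\<Union>e\<in>idents C. {x \<in> principal C e. deg x = m})"
    using finite_idents rows_finite unfolding row_finite_def by blast
  ultimately show ?thesis by (rule finite_subset)
qed

text \<open>
  A path lies in \<open>D\<close> iff its segment of a sufficiently large fixed degree does.  Hence the complement is generated
  by the finitely many arrows of that degree that are not in \<open>D\<close>.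
\<close>

lemma complement_ideal:
  assumes D: "fin_gen D"
  obtains E where "fin_gen E" "\<And>\<omega>. path \<omega> \<Longrightarrow> \<omega> \<inter> E \<noteq> {} \<longleftrightarrow> \<omega> \<inter> D = {}"
proof -
  obtain m where m: "\<And>a n x. a \<in> arrows C \<Longrightarrow> deg a = m + n \<Longrightarrow> x \<in> principal C a \<Longrightarrow> x \<in> D \<Longrightarrow> a \<in> D"
    by (rule fin_gen_degree_bound[OF D]) blast
  let ?X = "{a \<in> arrows C. deg a = m \<and> a \<notin> D}"
  show ?thesis
  proof (rule that)
    show "fin_gen (generated C ?X)"
      by (rule fin_gen_generated) (auto intro: finite_subset[OF _ finite_degree[of m]])
    fix \<omega> assume w: "path \<omega>"
    obtain a where a: "a \<in> \<omega>" "deg a = m" using path_ex[OF w] by blast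
    have aC: "a \<in> arrows C" using path_arrow w a by blast
    show "\<omega> \<inter> generated C ?X \<noteq> {} \<longleftrightarrow> \<omega> \<inter> D = {}"
    proof
      assume "\<omega> \<inter> generated C ?X \<noteq> {}"
      then obtain b x where "b \<in> \<omega>" "x \<in> ?X" "b \<in> principal C x" unfolding generated_def by blast
      then have "a \<notin> D" using path_prefix[OF w] path_unique[OF w a(1)] a(2) by blast
      show "\<omega> \<inter> D = {}"
      proof (rule ccontr)
        assume "\<omega> \<inter> D \<noteq> {}"
        then obtain d where d: "d \<in> \<omega>" "d \<in> D" by blast
        then obtain c e where ce: "composable a c" "composable d e" "a \<bullet> c = d \<bullet> e"
          using path_directed[OF w a(1)] by blast
        have "a \<bullet> c \<in> D" using fin_gen_right_closed[OF D d(2) ce(2)] ce(3) by simp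
        then have "a \<in> D" using m[OF aC, of 0] a(2) principalI[OF ce(1)] by simp
        then show False using \<open>a \<notin> D\<close> by blast
      qed
    next
      assume "\<omega> \<inter> D = {}"
      then have "a \<in> ?X" using a aC by blast
      then show "\<omega> \<inter> generated C ?X \<noteq> {}" using a(1) principal_self[OF aC] unfolding generated_def by blast
    qed
  qed
qed

section \<open>The kernel of the action\<close>

lemma restriction_in_R:
  assumes "\<theta> \<in> \<R>" "fin_gen D"
  shows "\<theta> |` D \<in> \<R>"
proof -
  have "\<theta> |` D = \<theta> \<circ>\<^sub>m (Some |` D)" by (auto simp: fun_eq_iff map_comp_def restrict_map_def)
  then show ?thesis using comp_in_R[OF aligned assms(1) identity_in_R[OF assms(2)]] by simp
qed

text \<open>
  If \<open>\<theta>\<close> and \<open>\<eta>\<close> agree at \<open>x \<bullet> c\<close>, they agree at \<open>x\<close> by right cancellation.  So the agreement set is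
  generated by those generators of \<open>dom \<theta> \<inter> dom \<eta>\<close> at which the maps agree.
\<close>

lemma agreement_fin_gen:
  assumes \<theta>: "\<theta> \<in> \<R>" and \<eta>: "\<eta> \<in> \<R>"
  shows "fin_gen {a. \<exists>b. \<theta> a = Some b \<and> \<eta> a = Some b}" (is "fin_gen ?E")
proof -
  obtain X where X: "X \<subseteq> arrows C" "finite X" "dom \<theta> \<inter> dom \<eta> = generated C X"
    using fin_gen_Int[OF aligned R_dom[OF \<theta>] R_dom[OF \<eta>]] unfolding fin_gen_def by blast
  have "?E = generated C (X \<inter> ?E)"
  proof (intro subset_antisym subsetI)
    fix a assume "a \<in> ?E"
    then obtain b where b: "\<theta> a = Some b" "\<eta> a = Some b" by blast
    then have "a \<in> generated C X" using X(3) by blast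
    then obtain x where x: "x \<in> X" "a \<in> principal C x" by (auto simp: generated_iff)
    obtain c where c: "composable x c" "a = x \<bullet> c" using principalE[OF x(2)] x(1) X(1) by blast
    have "x \<in> dom \<theta> \<inter> dom \<eta>" using x(1) generated_superset[OF X(1)] X(3) by blast
    then obtain u v where uv: "\<theta> x = Some u" "\<eta> x = Some v" by blast
    have "u \<bullet> c = v \<bullet> c"
      using b R_D(4)[OF \<theta> uv(1) c(1)] R_D(4)[OF \<eta> uv(2) c(1)] c(2) by simp
    then have "u = v"
      using right_cancel[of u c v] R_D(2,3)[OF \<theta> uv(1)] R_D(2,3)[OF \<eta> uv(2)] c(1) by simp
    then show "a \<in> generated C (X \<inter> ?E)" using x uv unfolding generated_iff by blast
  next
    fix a assume "a \<in> generated C (X \<inter> ?E)"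
    then obtain x b where x: "x \<in> X" "a \<in> principal C x" "\<theta> x = Some b" "\<eta> x = Some b"
      unfolding generated_iff by blast
    obtain c where c: "composable x c" "a = x \<bullet> c" using principalE[OF x(2)] x(1) X(1) by blast
    show "a \<in> ?E" using R_D(4)[OF \<theta> x(3) c(1)] R_D(4)[OF \<eta> x(4) c(1)] c(2) by blast
  qed
  then show ?thesis using fin_gen_generated[of "X \<inter> ?E"] X by (metis (no_types, lifting) finite_Int inf.coboundedI1)
qed

lemma lenz_R_iff:
  "(\<theta>, \<eta>) \<in> lenz (R_monoid C) \<longleftrightarrow> \<theta> \<in> \<R> \<and> \<eta> \<in> \<R> \<and>
    (\<forall>\<xi>\<in>\<R>. \<xi> \<noteq> Map.empty \<and> \<xi> \<subseteq>\<^sub>m \<theta> \<longrightarrow> (\<exists>\<zeta>\<in>\<R>. \<zeta> \<noteq> Map.empty \<and> \<zeta> \<subseteq>\<^sub>m \<xi> \<and> \<zeta> \<subseteq>\<^sub>m \<eta>)) \<and>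
    (\<forall>\<xi>\<in>\<R>. \<xi> \<noteq> Map.empty \<and> \<xi> \<subseteq>\<^sub>m \<eta> \<longrightarrow> (\<exists>\<zeta>\<in>\<R>. \<zeta> \<noteq> Map.empty \<and> \<zeta> \<subseteq>\<^sub>m \<xi> \<and> \<zeta> \<subseteq>\<^sub>m \<theta>))"
proof -
  have le: "\<xi> \<sqsubseteq>\<^bsub>natural_order (R_monoid C)\<^esub> \<zeta> \<longleftrightarrow> \<xi> \<subseteq>\<^sub>m \<zeta>" if "\<xi> \<in> \<R>" "\<zeta> \<in> \<R>" for \<xi> \<zeta>
    unfolding R.le_iff[OF that] by (auto simp: map_le_def dom_def)
  have zero: "zero_of (R_monoid C) = Map.empty" using R.rep_zero .
  have half: "(\<forall>\<xi>. \<xi> \<in> \<R> \<and> \<xi> \<noteq> Map.empty \<and> \<xi> \<sqsubseteq>\<^bsub>natural_order (R_monoid C)\<^esub> s \<longrightarrow>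
        (\<exists>\<zeta>. (\<zeta> \<in> \<R> \<and> \<zeta> \<noteq> Map.empty \<and> \<zeta> \<sqsubseteq>\<^bsub>natural_order (R_monoid C)\<^esub> \<xi>) \<and>
             (\<zeta> \<in> \<R> \<and> \<zeta> \<noteq> Map.empty \<and> \<zeta> \<sqsubseteq>\<^bsub>natural_order (R_monoid C)\<^esub> t))) \<longleftrightarrow>
      (\<forall>\<xi>\<in>\<R>. \<xi> \<noteq> Map.empty \<and> \<xi> \<subseteq>\<^sub>m s \<longrightarrow> (\<exists>\<zeta>\<in>\<R>. \<zeta> \<noteq> Map.empty \<and> \<zeta> \<subseteq>\<^sub>m \<xi> \<and> \<zeta> \<subseteq>\<^sub>m t))"
    if "s \<in> \<R>" "t \<in> \<R>" for s t
    using that by (simp add: le Ball_def Bex_def cong: conj_cong imp_cong) blast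
  show ?thesis
    unfolding lenz_def Let_def zero mem_Collect_eq prod.case
    using half[of \<theta> \<eta>] half[of \<eta> \<theta>] by argo
qed

text \<open>
  The Lenz condition says that below each arrow in \<open>dom \<theta>\<close> there is one at which \<open>\<theta>\<close> and \<open>\<eta>\<close> agree.  As the
  agreement set is finitely generated, a long enough segment of \<open>\<omega>\<close> must itself belong to it.
\<close>

lemma lenz_density:
  assumes \<theta>: "\<theta> \<in> \<R>" and \<eta>: "\<eta> \<in> \<R>"
    and L: "\<forall>\<xi>\<in>\<R>. \<xi> \<noteq> Map.empty \<and> \<xi> \<subseteq>\<^sub>m \<theta> \<longrightarrow> (\<exists>\<zeta>\<in>\<R>. \<zeta> \<noteq> Map.empty \<and> \<zeta> \<subseteq>\<^sub>m \<xi> \<and> \<zeta> \<subseteq>\<^sub>m \<eta>)"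
    and m: "moves \<theta> \<omega> z \<omega>' z'"
  shows "moves \<eta> \<omega> z \<omega>' z'"
proof -
  let ?E = "{a. \<exists>b. \<theta> a = Some b \<and> \<eta> a = Some b}"
  obtain m where m: "\<And>a n x. a \<in> arrows C \<Longrightarrow> deg a = m + n \<Longrightarrow> x \<in> principal C a \<Longrightarrow> x \<in> ?E \<Longrightarrow> a \<in> ?E"
    by (rule fin_gen_degree_bound[OF agreement_fin_gen[OF \<theta> \<eta>]]) blast
  obtain a b where g: "germ \<theta> a b \<omega> z \<omega>' z'" using \<open>moves \<theta> \<omega> z \<omega>' z'\<close> unfolding moves_def by blast
  obtain c where c: "composable a c" "a \<bullet> c \<in> \<omega>" "deg c = m"
    by (rule path_extend[OF germ_paths(1,3)[OF g]])
  \<comment> \<open>\<open>x\<close> is a segment of \<open>\<omega>\<close> long enough for the degree bound of the agreement set\<close>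
  define x where "x = a \<bullet> c"
  have gx: "germ \<theta> x (b \<bullet> c) \<omega> z \<omega>' z'" unfolding x_def by (rule germ_extend[OF \<theta> g c(1,2)])
  have x: "x \<in> arrows C" "deg x = m + deg a"
    using comp_closed[of a c] deg_comp[of a c] c by (auto simp: x_def add.commute)
  have \<theta>x: "\<theta> x = Some (b \<bullet> c)" using germ_paths(6)[OF gx] .
  have "\<theta> |` principal C x \<in> \<R>" by (rule restriction_in_R[OF \<theta> fin_gen_principal[OF x(1)]])
  moreover have "(\<theta> |` principal C x) x \<noteq> None" using \<theta>x principal_self[OF x(1)] by simp
  moreover have "\<theta> |` principal C x \<subseteq>\<^sub>m \<theta>" by (simp add: map_le_def)
  ultimately obtain \<zeta> where \<zeta>: "\<zeta> \<noteq> Map.empty" "\<zeta> \<subseteq>\<^sub>m \<theta> |` principal C x" "\<zeta> \<subseteq>\<^sub>m \<eta>"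
    using L by fastforce
  obtain p q where p: "\<zeta> p = Some q" using \<zeta>(1) by (metis not_None_eq ext)
  have "(\<theta> |` principal C x) p = Some q" "\<eta> p = Some q"
    using \<zeta>(2,3) p by (metis domI map_le_def)+
  then have "p \<in> principal C x" "p \<in> ?E" by (auto simp: restrict_map_def split: if_splits)
  then have "x \<in> ?E" using m[OF x] by blast
  then have "\<eta> x = Some (b \<bullet> c)" using \<theta>x by auto
  then have "germ \<eta> x (b \<bullet> c) \<omega> z \<omega>' z'" using gx unfolding germ_def by blast
  then show ?thesis unfolding moves_def by blast
qed

text \<open>
  For \<open>\<xi>\<close> below \<open>\<theta>\<close> pick a path through an arrow of \<open>dom \<xi>\<close>.  Since \<open>\<eta>\<close> moves it in the same way, \<open>\<xi>\<close> and
  \<open>\<eta>\<close> agree at some arrow \<open>x\<close> of the path, and the restriction of \<open>\<xi>\<close> to \<open>x C\<close> is below both.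
\<close>

lemma density_lenz:
  assumes \<theta>: "\<theta> \<in> \<R>" and \<eta>: "\<eta> \<in> \<R>"
    and m: "\<And>\<omega> z \<omega>' z'. moves \<theta> \<omega> z \<omega>' z' \<Longrightarrow> moves \<eta> \<omega> z \<omega>' z'"
    and \<xi>: "\<xi> \<in> \<R>" "\<xi> \<noteq> Map.empty" "\<xi> \<subseteq>\<^sub>m \<theta>"
  shows "\<exists>\<zeta>\<in>\<R>. \<zeta> \<noteq> Map.empty \<and> \<zeta> \<subseteq>\<^sub>m \<xi> \<and> \<zeta> \<subseteq>\<^sub>m \<eta>"
proof -
  obtain a b where ab: "\<xi> a = Some b" using \<xi>(2) by (metis not_None_eq ext)
  obtain \<omega> where w: "path \<omega>" "a \<in> \<omega>" by (rule path_through[OF sourceless R_D(1)[OF \<xi>(1) ab]])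
  obtain \<omega>1 z1 where g: "germ \<xi> a b \<omega> (\<lambda>i. 0) \<omega>1 z1" by (rule germ_ex[OF \<xi>(1) ab w])
  have "\<theta> a = Some b" using \<xi>(3) ab by (metis domI map_le_def)
  then have "moves \<theta> \<omega> (\<lambda>i. 0) \<omega>1 z1" using g unfolding moves_def germ_def by blast
  then obtain a' b' where h: "germ \<eta> a' b' \<omega> (\<lambda>i. 0) \<omega>1 z1" using m unfolding moves_def by blast
  obtain x u v where x: "germ \<xi> x u \<omega> (\<lambda>i. 0) \<omega>1 z1" "germ \<eta> x v \<omega> (\<lambda>i. 0) \<omega>1 z1"
    by (rule common_germs[OF \<xi>(1) \<eta> g h])
  have xu: "\<xi> x = Some u" "\<eta> x = Some u"
    using germ_value_unique[OF x] germ_paths(6)[OF x(1)] germ_paths(6)[OF x(2)] by auto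
  have xC: "x \<in> arrows C" using R_D(1)[OF \<xi>(1) xu(1)] .
  let ?\<zeta> = "\<xi> |` principal C x"
  have "?\<zeta> \<in> \<R>" by (rule restriction_in_R[OF \<xi>(1) fin_gen_principal[OF xC]])
  moreover have "?\<zeta> \<noteq> Map.empty"
    using xu(1) principal_self[OF xC] by (metis option.distinct(1) restrict_in)
  moreover have "?\<zeta> \<subseteq>\<^sub>m \<xi>" by (simp add: map_le_def)
  moreover have "?\<zeta> \<subseteq>\<^sub>m \<eta>" unfolding map_le_def
  proof
    fix p assume "p \<in> dom ?\<zeta>"
    then have p: "p \<in> principal C x" by auto
    obtain c where c: "composable x c" "p = x \<bullet> c" by (rule principalE[OF p xC])
    show "?\<zeta> p = \<eta> p"
      using p R_D(4)[OF \<xi>(1) xu(1) c(1)] R_D(4)[OF \<eta> xu(2) c(1)] c(2) by simp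
  qed
  ultimately show ?thesis by blast
qed

lemma lenz_iff_moves:
  "(\<theta>, \<eta>) \<in> lenz (R_monoid C) \<longleftrightarrow> \<theta> \<in> \<R> \<and> \<eta> \<in> \<R> \<and>
    (\<forall>\<omega> z \<omega>' z'. moves \<theta> \<omega> z \<omega>' z' \<longleftrightarrow> moves \<eta> \<omega> z \<omega>' z')"
  unfolding lenz_R_iff using lenz_density[of \<theta> \<eta>] lenz_density[of \<eta> \<theta>] density_lenz[of \<theta> \<eta>] density_lenz[of \<eta> \<theta>]
  by meson

end


section \<open>The quotient \<open>B(C)\<close> as a monoid of partial bijections\<close>

context row_finite_graph
begin

definition cls :: "('a \<rightharpoonup> 'a) \<Rightarrow> ('a \<rightharpoonup> 'a) set" where
  "cls \<theta> = lenz (R_monoid C) `` {\<theta>}"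

definition action :: "('a \<rightharpoonup> 'a) \<Rightarrow> ('a set \<times> ('k \<Rightarrow> int)) \<rightharpoonup> ('a set \<times> ('k \<Rightarrow> int))" where
  "action \<theta> = (\<lambda>(\<omega>, z). if \<exists>\<omega>' z'. moves \<theta> \<omega> z \<omega>' z'
     then Some (SOME p. moves \<theta> \<omega> z (fst p) (snd p)) else None)"

text \<open>
  The action is constant on Lenz classes, so the choice of a representative is immaterial.
\<close>

definition class_action :: "('a \<rightharpoonup> 'a) set \<Rightarrow> ('a set \<times> ('k \<Rightarrow> int)) \<rightharpoonup> ('a set \<times> ('k \<Rightarrow> int))" where
  "class_action A = action (SOME \<theta>. \<theta> \<in> A)"

lemma action_Some:
  assumes "\<theta> \<in> \<R>"
  shows "action \<theta> (\<omega>, z) = Some (\<omega>', z') \<longleftrightarrow> moves \<theta> \<omega> z \<omega>' z'"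
proof -
  have some: "(SOME p. moves \<theta> \<omega> z (fst p) (snd p)) = (\<omega>1, z1)" if m: "moves \<theta> \<omega> z \<omega>1 z1" for \<omega>1 z1
  proof (rule some_equality)
    fix p assume "moves \<theta> \<omega> z (fst p) (snd p)"
    then show "p = (\<omega>1, z1)" using moves_functional[OF assms _ m] by (simp add: prod_eq_iff)
  qed (simp add: m)
  show ?thesis
  proof
    assume a: "action \<theta> (\<omega>, z) = Some (\<omega>', z')"
    then obtain \<omega>1 z1 where m: "moves \<theta> \<omega> z \<omega>1 z1" by (auto simp: action_def split: if_splits)
    then have "action \<theta> (\<omega>, z) = Some (\<omega>1, z1)" using some by (auto simp: action_def)
    then show "moves \<theta> \<omega> z \<omega>' z'" using a m by simp
  next
    assume "moves \<theta> \<omega> z \<omega>' z'"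
    then show "action \<theta> (\<omega>, z) = Some (\<omega>', z')" using some by (auto simp: action_def)
  qed
qed

lemma lenz_iff_action:
  "(\<theta>, \<eta>) \<in> lenz (R_monoid C) \<longleftrightarrow> \<theta> \<in> \<R> \<and> \<eta> \<in> \<R> \<and> action \<theta> = action \<eta>"
proof (cases "\<theta> \<in> \<R> \<and> \<eta> \<in> \<R>")
  case True
  have "action \<theta> = action \<eta> \<longleftrightarrow> (\<forall>x y. action \<theta> x = Some y \<longleftrightarrow> action \<eta> x = Some y)"
    by (metis ext not_Some_eq)
  also have "\<dots> \<longleftrightarrow> (\<forall>\<omega> z \<omega>' z'. moves \<theta> \<omega> z \<omega>' z' \<longleftrightarrow> moves \<eta> \<omega> z \<omega>' z')"
    using True by (simp add: action_Some)
  finally show ?thesis using True lenz_iff_moves by simp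
qed (auto simp: lenz_iff_moves)

lemma cls_iff: "\<theta> \<in> \<R> \<Longrightarrow> \<eta> \<in> cls \<theta> \<longleftrightarrow> \<eta> \<in> \<R> \<and> action \<eta> = action \<theta>"
  by (auto simp: cls_def lenz_iff_action)

lemma cls_eq_iff: "\<theta> \<in> \<R> \<Longrightarrow> \<eta> \<in> \<R> \<Longrightarrow> cls \<theta> = cls \<eta> \<longleftrightarrow> action \<theta> = action \<eta>"
  using cls_iff by auto

lemma B_carrier: "carrier (B_monoid C) = cls ` \<R>"
  by (auto simp: B_monoid_def quotient_monoid_def quotient_def cls_def)

lemma B_carrierE:
  assumes "s \<in> carrier (B_monoid C)"
  obtains \<theta> where "\<theta> \<in> \<R>" "s = cls \<theta>"
  using assms B_carrier by auto

lemma cls_in_B: "\<theta> \<in> \<R> \<Longrightarrow> cls \<theta> \<in> carrier (B_monoid C)"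
  by (simp add: B_carrier)

lemma class_action_cls: "\<theta> \<in> \<R> \<Longrightarrow> class_action (cls \<theta>) = action \<theta>"
  using someI[of "\<lambda>\<eta>. \<eta> \<in> cls \<theta>" \<theta>] by (auto simp: class_action_def cls_iff)

lemma class_action_Some:
  "\<theta> \<in> \<R> \<Longrightarrow> class_action (cls \<theta>) (\<omega>, z) = Some (\<omega>', z') \<longleftrightarrow> moves \<theta> \<omega> z \<omega>' z'"
  by (simp add: class_action_cls action_Some)

lemma R_mult_closed: "\<theta> \<in> \<R> \<Longrightarrow> \<eta> \<in> \<R> \<Longrightarrow> \<theta> \<circ>\<^sub>m \<eta> \<in> \<R>"
  using comp_in_R[OF aligned] .

lemma action_comp:
  assumes "\<theta> \<in> \<R>" "\<eta> \<in> \<R>"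
  shows "action (\<theta> \<circ>\<^sub>m \<eta>) = action \<theta> \<circ>\<^sub>m action \<eta>"
proof -
  have "action (\<theta> \<circ>\<^sub>m \<eta>) x = Some y \<longleftrightarrow> (action \<theta> \<circ>\<^sub>m action \<eta>) x = Some y" for x y
    using assms R_mult_closed[OF assms]
    by (cases x; cases y) (simp add: action_Some moves_comp map_comp_Some_iff)
  then show ?thesis by (metis ext not_Some_eq)
qed

lemma B_mult:
  assumes \<theta>: "\<theta> \<in> \<R>" and \<eta>: "\<eta> \<in> \<R>"
  shows "cls \<theta> \<otimes>\<^bsub>B_monoid C\<^esub> cls \<eta> = cls (\<theta> \<circ>\<^sub>m \<eta>)"
proof -
  have eq: "lenz (R_monoid C) `` {a \<otimes>\<^bsub>R_monoid C\<^esub> b} = cls (\<theta> \<circ>\<^sub>m \<eta>)" if "a \<in> cls \<theta>" "b \<in> cls \<eta>" for a b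
  proof -
    have ab: "a \<in> \<R>" "b \<in> \<R>" "action a = action \<theta>" "action b = action \<eta>"
      using that cls_iff \<theta> \<eta> by auto
    then have "cls (a \<circ>\<^sub>m b) = cls (\<theta> \<circ>\<^sub>m \<eta>)"
      using cls_eq_iff R_mult_closed action_comp \<theta> \<eta> by simp
    then show ?thesis by (simp add: cls_def R_mult)
  qed
  have "\<theta> \<in> cls \<theta>" "\<eta> \<in> cls \<eta>" using cls_iff \<theta> \<eta> by auto
  then have "(\<Union>a\<in>cls \<theta>. \<Union>b\<in>cls \<eta>. lenz (R_monoid C) `` {a \<otimes>\<^bsub>R_monoid C\<^esub> b}) = cls (\<theta> \<circ>\<^sub>m \<eta>)"
    using eq by blast
  then show ?thesis by (simp add: B_monoid_def quotient_monoid_def)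
qed

lemma B_one: "\<one>\<^bsub>B_monoid C\<^esub> = cls (Some |` arrows C)"
  by (simp add: B_monoid_def quotient_monoid_def cls_def R_one)

lemma class_union:
  assumes \<theta>: "\<theta> \<in> \<R>" and \<eta>: "\<eta> \<in> \<R>"
    and c1: "\<And>x y z. class_action (cls \<theta>) x = Some y \<Longrightarrow> class_action (cls \<eta>) x = Some z \<Longrightarrow> y = z"
    and c2: "\<And>x y z. class_action (cls \<theta>) x = Some z \<Longrightarrow> class_action (cls \<eta>) y = Some z \<Longrightarrow> x = y"
  shows "\<theta> ++ \<eta> \<in> \<R> \<and> (\<forall>x y. class_action (cls (\<theta> ++ \<eta>)) x = Some y \<longleftrightarrow>
    class_action (cls \<theta>) x = Some y \<or> class_action (cls \<eta>) x = Some y)"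
proof -
  have u: "\<theta> ++ \<eta> \<in> \<R> \<and> (\<forall>a b. (\<theta> ++ \<eta>) a = Some b \<longleftrightarrow> \<theta> a = Some b \<or> \<eta> a = Some b)"
  proof (rule compatible_union_in_R[OF \<theta> \<eta>])
    fix \<omega> z \<omega>1 z1 \<omega>2 z2
    show "\<omega>1 = \<omega>2 \<and> z1 = z2" if "moves \<theta> \<omega> z \<omega>1 z1" "moves \<eta> \<omega> z \<omega>2 z2"
      using c1[of "(\<omega>, z)" "(\<omega>1, z1)" "(\<omega>2, z2)"] that class_action_Some \<theta> \<eta> by simp
    show "\<omega>1 = \<omega>2 \<and> z1 = z2" if "moves \<theta> \<omega>1 z1 \<omega> z" "moves \<eta> \<omega>2 z2 \<omega> z"
      using c2[of "(\<omega>1, z1)" "(\<omega>, z)" "(\<omega>2, z2)"] that class_action_Some \<theta> \<eta> by simp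
  qed
  then have "moves (\<theta> ++ \<eta>) \<omega> z \<omega>' z' \<longleftrightarrow> moves \<theta> \<omega> z \<omega>' z' \<or> moves \<eta> \<omega> z \<omega>' z'" for \<omega> z \<omega>' z'
    by (intro moves_union) blast
  then show ?thesis using u \<theta> \<eta> by (simp add: class_action_Some)
qed

definition points :: "('a set \<times> ('k \<Rightarrow> int)) set" where
  "points = {(\<omega>, z). path \<omega>}"

lemma moves_total_identity:
  "moves (Some |` arrows C) \<omega> z \<omega>' z' \<longleftrightarrow> path \<omega> \<and> \<omega>' = \<omega> \<and> z' = z"
proof -
  have "\<omega> \<inter> arrows C \<noteq> {}" if "path \<omega>"
    using path_ex[OF that] path_arrow[OF that] by blast
  then show ?thesis by (auto simp: moves_identity)
qed

text \<open>
  All conditions on the representation reduce to facts about \<open>moves\<close> for representatives: complements come from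
  \<open>complement_ideal\<close>, unions from \<open>class_union\<close>.
\<close>

sublocale B: boolean_partial_bijection_rep "B_monoid C" class_action points
proof
  show "inj_on class_action (carrier (B_monoid C))"
    by (auto simp: inj_on_def B_carrier class_action_cls cls_eq_iff)
  fix s assume s: "s \<in> carrier (B_monoid C)"
  then obtain \<theta> where \<theta>: "\<theta> \<in> \<R>" "s = cls \<theta>" by (rule B_carrierE)
  show "x \<in> points" if "class_action s x = Some y" for x y
    using that unfolding \<theta>(2)
    by (cases x; cases y) (auto simp: class_action_Some[OF \<theta>(1)] points_def moves_def dest: germ_paths)
  show "\<exists>t\<in>carrier (B_monoid C). \<forall>x y. class_action t y = Some x \<longleftrightarrow> class_action s x = Some y"
    using \<theta> converse_in_R[OF \<theta>(1)]
    by (intro bexI[of _ "cls (converse_map \<theta>)"]) (auto simp: class_action_Some moves_converse cls_in_B)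
  show "\<exists>f\<in>carrier (B_monoid C). \<forall>x y. class_action f x = Some y \<longleftrightarrow> x \<in> points \<and> y = x \<and> class_action s x = None"
  proof -
    obtain E where E: "fin_gen E" "\<And>\<omega>. path \<omega> \<Longrightarrow> \<omega> \<inter> E \<noteq> {} \<longleftrightarrow> \<omega> \<inter> dom \<theta> = {}"
      by (rule complement_ideal[OF R_dom[OF \<theta>(1)]]) blast
    have none: "class_action s (\<omega>, z) = None \<longleftrightarrow> \<not> (path \<omega> \<and> \<omega> \<inter> dom \<theta> \<noteq> {})" for \<omega> z
      unfolding moves_dom[OF \<theta>(1), of \<omega> z, symmetric] \<theta>(2) class_action_Some[OF \<theta>(1), symmetric]
      by (cases "class_action (cls \<theta>) (\<omega>, z)") auto
    show ?thesis
      using identity_in_R[OF E(1)] E(2)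
      by (intro bexI[of _ "cls (Some |` E)"])
        (auto simp: class_action_Some moves_identity points_def none cls_in_B)
  qed
  fix t assume t: "t \<in> carrier (B_monoid C)"
  then obtain \<eta> where \<eta>: "\<eta> \<in> \<R>" "t = cls \<eta>" by (rule B_carrierE)
  show "s \<otimes>\<^bsub>B_monoid C\<^esub> t \<in> carrier (B_monoid C)"
    "class_action (s \<otimes>\<^bsub>B_monoid C\<^esub> t) = class_action s \<circ>\<^sub>m class_action t"
    using \<theta> \<eta> R_mult_closed[OF \<theta>(1) \<eta>(1)] by (simp_all add: B_mult cls_in_B class_action_cls action_comp)
  assume c1: "\<And>x y z. class_action s x = Some y \<Longrightarrow> class_action t x = Some z \<Longrightarrow> y = z"
    and c2: "\<And>x y z. class_action s x = Some z \<Longrightarrow> class_action t y = Some z \<Longrightarrow> x = y"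
  have "\<theta> ++ \<eta> \<in> \<R> \<and> (\<forall>x y. class_action (cls (\<theta> ++ \<eta>)) x = Some y \<longleftrightarrow>
    class_action (cls \<theta>) x = Some y \<or> class_action (cls \<eta>) x = Some y)"
    by (rule class_union[OF \<theta>(1) \<eta>(1)])
      (use c1[unfolded \<theta>(2) \<eta>(2)] c2[unfolded \<theta>(2) \<eta>(2)] in blast)+
  then show "\<exists>c\<in>carrier (B_monoid C). \<forall>x y. class_action c x = Some y \<longleftrightarrow> class_action s x = Some y \<or> class_action t x = Some y"
    using cls_in_B unfolding \<theta>(2) \<eta>(2) by blast
next
  have id: "Some |` arrows C \<in> \<R>" using identity_in_R fin_gen_all[OF finite_idents] by blast
  then show "\<one>\<^bsub>B_monoid C\<^esub> \<in> carrier (B_monoid C)" by (simp add: B_one cls_in_B)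
  have "class_action \<one>\<^bsub>B_monoid C\<^esub> x = Some y \<longleftrightarrow> (Some |` points) x = Some y" for x y
    by (cases x; cases y) (auto simp: B_one class_action_Some[OF id] moves_total_identity points_def restrict_Some)
  then show "class_action \<one>\<^bsub>B_monoid C\<^esub> = Some |` points" by (metis ext not_Some_eq)
  have "class_action (cls Map.empty) x = None" for x
    using class_action_Some[OF empty_in_R] unfolding moves_def germ_def
    by (cases x; cases "class_action (cls Map.empty) x") auto
  then show "\<exists>z\<in>carrier (B_monoid C). class_action z = Map.empty"
    using cls_in_B[OF empty_in_R] by blast
qed

lemma cls_idempotent_iff:
  "\<theta> \<in> \<R> \<Longrightarrow> cls \<theta> \<in> idempotents (B_monoid C) \<longleftrightarrow> (\<forall>\<omega> z \<omega>' z'. moves \<theta> \<omega> z \<omega>' z' \<longrightarrow> \<omega>' = \<omega> \<and> z' = z)"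
  by (simp add: B.idempotent_iff cls_in_B class_action_Some)

text \<open>
  The idempotent of \<open>B(C)\<close> determined by a right ideal; it is the identity on the graded paths that
  meet \<open>D\<close>.
\<close>

definition proj :: "'a set \<Rightarrow> ('a \<rightharpoonup> 'a) set" where
  "proj D = cls (Some |` D)"

lemma proj_in_B: "fin_gen D \<Longrightarrow> proj D \<in> carrier (B_monoid C)"
  by (simp add: proj_def identity_in_R cls_in_B)

lemma proj_Some:
  "fin_gen D \<Longrightarrow> class_action (proj D) (\<omega>, z) = Some (\<omega>', z') \<longleftrightarrow> path \<omega> \<and> \<omega> \<inter> D \<noteq> {} \<and> \<omega>' = \<omega> \<and> z' = z"
  by (simp add: proj_def identity_in_R class_action_Some moves_identity)

lemma proj_idempotent: "fin_gen D \<Longrightarrow> proj D \<in> idempotents (B_monoid C)"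
  by (simp add: B.idempotent_iff proj_in_B proj_Some)

lemma dom_proj: "fin_gen D \<Longrightarrow> dom (class_action (proj D)) = {(\<omega>, z). path \<omega> \<and> \<omega> \<inter> D \<noteq> {}}"
proof -
  assume D: "fin_gen D"
  have "(\<omega>, z) \<in> dom (class_action (proj D)) \<longleftrightarrow> path \<omega> \<and> \<omega> \<inter> D \<noteq> {}" for \<omega> z
    using proj_Some[OF D, of \<omega> z] by (cases "class_action (proj D) (\<omega>, z)") auto
  then show ?thesis by (simp add: set_eq_iff del: domIff)
qed

lemma idempotent_is_proj:
  assumes "e \<in> idempotents (B_monoid C)"
  obtains D where "fin_gen D" "e = proj D"
proof -
  have e: "e \<in> carrier (B_monoid C)" using assms by (simp add: B.idempotent_iff)
  then obtain \<theta> where \<theta>: "\<theta> \<in> \<R>" "e = cls \<theta>" by (rule B_carrierE)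
  note D = R_dom[OF \<theta>(1)]
  have "(\<omega>, z) \<in> dom (class_action e) \<longleftrightarrow> path \<omega> \<and> \<omega> \<inter> dom \<theta> \<noteq> {}" for \<omega> z
    unfolding moves_dom[OF \<theta>(1), of \<omega> z, symmetric] \<theta>(2) class_action_Some[OF \<theta>(1), symmetric]
    by (cases "class_action (cls \<theta>) (\<omega>, z)") auto
  then have "dom (class_action e) = dom (class_action (proj (dom \<theta>)))"
    unfolding dom_proj[OF D] by (simp add: set_eq_iff del: domIff)
  then show ?thesis using that[OF D] B.idempotent_eqI[OF assms proj_idempotent[OF D]] by blast
qed

section \<open>Aperiodicity\<close>

text \<open>
  Suppose \<open>\<theta> a = b\<close> with \<open>b \<noteq> a\<close> and take \<open>u\<close> such that \<open>a \<bullet> u\<close> and \<open>b \<bullet> u\<close> are independent.  A path through \<open>a \<bullet> u\<close>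
  goes to a path through \<open>b \<bullet> u\<close>.  Commuting with the projection of \<open>a u C\<close> would force the latter to
  pass through \<open>a \<bullet> u\<close> as well, which independence forbids.
\<close>

lemma aperiodic_imp_fundamental:
  assumes ap: "aperiodic_category C"
  shows "fundamental (B_monoid C)"
  unfolding fundamental_def
proof (intro ballI impI)
  fix s assume s: "s \<in> carrier (B_monoid C)"
    and comm: "\<forall>e\<in>idempotents (B_monoid C). s \<otimes>\<^bsub>B_monoid C\<^esub> e = e \<otimes>\<^bsub>B_monoid C\<^esub> s"
  obtain \<theta> where \<theta>: "\<theta> \<in> \<R>" "s = cls \<theta>" using s by (rule B_carrierE)
  have fix_arrow: "a = b" if ab: "\<theta> a = Some b" for a b
  proof (rule ccontr)
    assume "a \<noteq> b"
    then obtain u where u: "u \<in> arrows C" "ccod C u = cdom C a" "independent_arrows C (a \<bullet> u) (b \<bullet> u)"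
      using ap R_D(1-3)[OF \<theta>(1) ab] unfolding aperiodic_category_def by metis
    have au: "composable a u" "composable b u" using u R_D(1-3)[OF \<theta>(1) ab] by simp_all
    have C: "a \<bullet> u \<in> arrows C" "b \<bullet> u \<in> arrows C" using comp_closed au by blast+
    have \<theta>u: "\<theta> (a \<bullet> u) = Some (b \<bullet> u)" by (rule R_D(4)[OF \<theta>(1) ab au(1)])
    obtain \<omega> where w: "path \<omega>" "a \<bullet> u \<in> \<omega>" by (rule path_through[OF sourceless C(1)])
    obtain \<omega>' z' where g: "germ \<theta> (a \<bullet> u) (b \<bullet> u) \<omega> (\<lambda>i. 0) \<omega>' z'" by (rule germ_ex[OF \<theta>(1) \<theta>u w])
    let ?P = "principal C (a \<bullet> u)"
    have P: "fin_gen ?P" by (rule fin_gen_principal[OF C(1)])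
    have sw: "class_action s (\<omega>, (\<lambda>i. 0)) = Some (\<omega>', z')"
      using g class_action_Some[OF \<theta>(1)] \<theta>(2) unfolding moves_def by blast
    have pw: "class_action (proj ?P) (\<omega>, (\<lambda>i. 0)) = Some (\<omega>, (\<lambda>i. 0))"
      unfolding proj_Some[OF P] using w principal_self[OF C(1)] by blast
    have "class_action (s \<otimes>\<^bsub>B_monoid C\<^esub> proj ?P) (\<omega>, (\<lambda>i. 0)) = Some (\<omega>', z')"
      unfolding B.mult_Some[OF s proj_in_B[OF P]] using sw pw by blast
    then have "class_action (proj ?P \<otimes>\<^bsub>B_monoid C\<^esub> s) (\<omega>, (\<lambda>i. 0)) = Some (\<omega>', z')"
      using comm proj_idempotent[OF P] by simp
    then obtain y where "class_action s (\<omega>, (\<lambda>i. 0)) = Some y" "class_action (proj ?P) y = Some (\<omega>', z')"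
      unfolding B.mult_Some[OF proj_in_B[OF P] s] by blast
    then have "class_action (proj ?P) (\<omega>', z') = Some (\<omega>', z')" using sw by simp
    then obtain x where x: "x \<in> \<omega>'" "x \<in> ?P" unfolding proj_Some[OF P] by blast
    obtain c d where cd: "composable x c" "composable (b \<bullet> u) d" "x \<bullet> c = (b \<bullet> u) \<bullet> d"
      by (rule path_directed[OF germ_paths(2)[OF g] x(1) germ_paths(4)[OF g]])
    have "x \<bullet> c \<in> ?P" by (rule principal_trans[OF principalI[OF cd(1)] x(2) C(1)])
    moreover have "x \<bullet> c \<in> principal C (b \<bullet> u)" using principalI[OF cd(2)] cd(3) by simp
    ultimately show False using u(3) unfolding independent_arrows_def by blast
  qed
  have "\<omega>' = \<omega> \<and> z' = z" if m: "moves \<theta> \<omega> z \<omega>' z'" for \<omega> z \<omega>' z'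
  proof -
    obtain a b where g: "germ \<theta> a b \<omega> z \<omega>' z'" using m unfolding moves_def by blast
    then have "b = a" using fix_arrow germ_paths(6) by blast
    moreover have "germ (Some |` {a}) a a \<omega> z \<omega> z"
      using linked_refl germ_paths[OF g] by (simp add: germ_def)
    ultimately show ?thesis using germ_target_unique[OF g] by blast
  qed
  then show "s \<in> idempotents (B_monoid C)" using cls_idempotent_iff \<theta> by blast
qed

text \<open>
  The morphism \<open>a \<bullet> c \<mapsto> b \<bullet> c\<close> from \<open>a C\<close> onto \<open>b C\<close>; \<open>c\<close> is unique by left cancellation.
\<close>

definition shift :: "'a \<Rightarrow> 'a \<Rightarrow> 'a \<rightharpoonup> 'a" where
  "shift a b = (\<lambda>x. if x \<in> principal C a then Some (b \<bullet> (THE c. composable a c \<and> x = a \<bullet> c)) else None)"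

lemma shift_comp: "composable a c \<Longrightarrow> shift a b (a \<bullet> c) = Some (b \<bullet> c)"
proof -
  assume c: "composable a c"
  have "(THE c'. composable a c' \<and> a \<bullet> c = a \<bullet> c') = c"
    using c left_cancel[of a] by (intro the_equality) auto
  then show ?thesis using principalI[OF c] by (simp add: shift_def)
qed

lemma shift_base:
  assumes "a \<in> arrows C" "b \<in> arrows C" "cdom C a = cdom C b"
  shows "shift a b a = Some b"
  using shift_comp[OF composable_dom[OF assms(1)], of b] comp_dom[OF assms(1)] comp_dom[OF assms(2)] assms(3)
  by metis

lemma shift_Some:
  assumes "a \<in> arrows C"
  shows "shift a b x = Some y \<longleftrightarrow> (\<exists>c. composable a c \<and> x = a \<bullet> c \<and> y = b \<bullet> c)"
proof
  assume s: "shift a b x = Some y"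
  then have "x \<in> principal C a" by (simp add: shift_def split: if_splits)
  then obtain c where c: "composable a c" "x = a \<bullet> c" using assms by (rule principalE)
  then show "\<exists>c. composable a c \<and> x = a \<bullet> c \<and> y = b \<bullet> c" using s shift_comp[OF c(1)] by auto
next
  assume "\<exists>c. composable a c \<and> x = a \<bullet> c \<and> y = b \<bullet> c"
  then show "shift a b x = Some y" using shift_comp by blast
qed

lemma dom_shift: "dom (shift a b) = principal C a"
  by (auto simp: shift_def dom_def)

lemma shift_in_R:
  assumes ab: "a \<in> arrows C" "b \<in> arrows C" "cdom C a = cdom C b"
  shows "shift a b \<in> \<R>"
proof -
  have "ideal_embedding (shift a b)"
    unfolding ideal_embedding_def
  proof (intro conjI allI impI)
    fix x y assume "shift a b x = Some y"
    then obtain c where c: "composable a c" "x = a \<bullet> c" "y = b \<bullet> c" unfolding shift_Some[OF ab(1)] by blast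
    have bc: "composable b c" using c ab by simp
    show "x \<in> arrows C" "y \<in> arrows C" "cdom C y = cdom C x"
      using c bc comp_closed dom_comp by simp_all
  next
    fix x y d assume a: "shift a b x = Some y \<and> d \<in> arrows C \<and> cdom C x = ccod C d"
    then obtain c where c: "composable a c" "x = a \<bullet> c" "y = b \<bullet> c" unfolding shift_Some[OF ab(1)] by blast
    have bc: "composable b c" using c ab by simp
    have d: "composable c d" using a c dom_comp[of a c] by simp
    have "x \<bullet> d = a \<bullet> (c \<bullet> d)" "y \<bullet> d = b \<bullet> (c \<bullet> d)" "composable a (c \<bullet> d)"
      using composable_assoc'[OF c(1) d] composable_assoc'[OF bc d] c by simp_all
    then show "shift a b (x \<bullet> d) = Some (y \<bullet> d)" using shift_comp by simp
  next
    fix x x' y assume s: "shift a b x = Some y \<and> shift a b x' = Some y"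
    obtain c where c: "composable a c" "x = a \<bullet> c" "y = b \<bullet> c"
      using conjunct1[OF s] unfolding shift_Some[OF ab(1)] by blast
    obtain c' where c': "composable a c'" "x' = a \<bullet> c'" "y = b \<bullet> c'"
      using conjunct2[OF s] unfolding shift_Some[OF ab(1)] by blast
    have "composable b c" "composable b c'" "b \<bullet> c = b \<bullet> c'" using c c' ab by metis+
    then have "c = c'" by (rule left_cancel)
    then show "x = x'" using c(2) c'(2) by simp
  qed
  then show ?thesis using fin_gen_principal[OF ab(1)] by (simp add: R_carrier_iff dom_shift)
qed

text \<open>
  If \<open>a \<bullet> u\<close> and \<open>b \<bullet> u\<close> are dependent for all \<open>u\<close>, then a path through \<open>a\<close> and the path obtained by
  replacing \<open>a\<close> by \<open>b\<close> have the same initial segments.  So \<open>shift a b\<close> only changes grades and commutes with all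
  projections.  If it were idempotent, \<open>a\<close> and \<open>b\<close> would be arrows of equal degree on one path, hence equal.
\<close>

lemma fundamental_imp_aperiodic:
  assumes fund: "fundamental (B_monoid C)"
  shows "aperiodic_category C"
proof (rule ccontr)
  assume "\<not> aperiodic_category C"
  then obtain a b where ab: "a \<in> arrows C" "b \<in> arrows C" "a \<noteq> b" "cdom C a = cdom C b"
    and dep: "\<And>u. u \<in> arrows C \<Longrightarrow> ccod C u = cdom C a \<Longrightarrow> \<not> independent_arrows C (a \<bullet> u) (b \<bullet> u)"
    unfolding aperiodic_category_def by blast
  have R: "shift a b \<in> \<R>" by (rule shift_in_R[OF ab(1,2,4)])
  have link_eq: "\<omega> = \<omega>'" if l: "linked \<omega> a \<omega>' b" for \<omega> \<omega>'
  proof (rule path_eqI)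
    show w: "path \<omega>" "path \<omega>'" using l by (auto simp: linked_def)
    have aw: "a \<in> \<omega>" using l by (simp add: linked_def)
    show "\<omega> \<subseteq> \<omega>'"
    proof
      fix p assume p: "p \<in> \<omega>"
      obtain u where u: "composable a u" "a \<bullet> u \<in> \<omega>" "deg u = deg p"
        by (rule path_extend[OF w(1) aw])
      have bu: "composable b u" "b \<bullet> u \<in> \<omega>'" using l u ab unfolding linked_def by auto
      obtain y where y: "y \<in> principal C (a \<bullet> u)" "y \<in> principal C (b \<bullet> u)"
        using dep[of u] u unfolding independent_arrows_def by auto
      have C: "a \<bullet> u \<in> arrows C" "b \<bullet> u \<in> arrows C" "p \<in> arrows C"
        using comp_closed u bu path_arrow[OF w(1) p] by blast+
      have d: "deg (a \<bullet> u) = deg p + deg a" "deg (b \<bullet> u) = deg p + deg b"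
        using deg_comp[of a u] deg_comp[of b u] u bu by (auto simp: add.commute)
      have yp: "y \<in> principal C p"
        by (rule principal_trans[OF y(1) path_longer[OF w(1) p u(2) d(1)] C(3)])
      have "b \<bullet> u \<in> principal C p" by (rule prefix_of_prefix[OF y(2) yp C(2,3) d(2)])
      then show "p \<in> \<omega>'" using path_prefix[OF w(2) bu(2)] C(3) by blast
    qed
  qed
  have mv: "\<omega>' = \<omega> \<and> a \<in> \<omega> \<and> b \<in> \<omega> \<and> (\<forall>i. z' i + int (deg a $ i) = z i + int (deg b $ i))"
    if m: "moves (shift a b) \<omega> z \<omega>' z'" for \<omega> z \<omega>' z'
  proof -
    obtain x y where g: "germ (shift a b) x y \<omega> z \<omega>' z'" using m unfolding moves_def by blast
    obtain c where c: "composable a c" "x = a \<bullet> c" using shift_Some[OF ab(1)] germ_paths(6)[OF g] by blast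
    have aw: "a \<in> \<omega>" using path_prefix_comp[OF germ_paths(1)[OF g]] germ_paths(3)[OF g] c by blast
    obtain \<omega>1 z1 where h: "germ (shift a b) a b \<omega> z \<omega>1 z1"
      by (rule germ_ex[OF R shift_base[OF ab(1,2,4)] germ_paths(1)[OF g] aw])
    have "\<omega>1 = \<omega>' \<and> z1 = z'" by (rule moves_functional[OF R _ m]) (use h in \<open>auto simp: moves_def\<close>)
    then have h': "germ (shift a b) a b \<omega> z \<omega>' z'" using h by simp
    then have "linked \<omega> a \<omega>' b" by (simp add: germ_def)
    then have "\<omega>' = \<omega>" by (rule link_eq[symmetric])
    then show ?thesis using h' germ_paths(3,4)[OF h'] by (simp add: germ_def)
  qed
  have "cls (shift a b) \<otimes>\<^bsub>B_monoid C\<^esub> e = e \<otimes>\<^bsub>B_monoid C\<^esub> cls (shift a b)" if "e \<in> idempotents (B_monoid C)" for e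
  proof -
    obtain D where D: "fin_gen D" "e = proj D" using \<open>e \<in> idempotents (B_monoid C)\<close> by (rule idempotent_is_proj)
    note S = cls_in_B[OF R] and P = proj_in_B[OF D(1)]
    show ?thesis unfolding D(2)
    proof (rule B.rep_eqI)
      fix x y :: "'a set \<times> ('k \<Rightarrow> int)"
      obtain \<omega> z \<omega>' z' where xy: "x = (\<omega>, z)" "y = (\<omega>', z')" by (cases x; cases y)
      have "class_action (cls (shift a b) \<otimes>\<^bsub>B_monoid C\<^esub> proj D) x = Some y \<longleftrightarrow>
         moves (shift a b) \<omega> z \<omega>' z' \<and> path \<omega> \<and> \<omega> \<inter> D \<noteq> {}"
        unfolding B.mult_Some[OF S P] xy split_paired_Ex proj_Some[OF D(1)] class_action_Some[OF R] by blast
      moreover have "class_action (proj D \<otimes>\<^bsub>B_monoid C\<^esub> cls (shift a b)) x = Some y \<longleftrightarrow>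
         moves (shift a b) \<omega> z \<omega>' z' \<and> path \<omega>' \<and> \<omega>' \<inter> D \<noteq> {}"
        unfolding B.mult_Some[OF P S] xy split_paired_Ex proj_Some[OF D(1)] class_action_Some[OF R] by blast
      ultimately show "class_action (cls (shift a b) \<otimes>\<^bsub>B_monoid C\<^esub> proj D) x = Some y \<longleftrightarrow>
        class_action (proj D \<otimes>\<^bsub>B_monoid C\<^esub> cls (shift a b)) x = Some y"
        using mv by metis
    qed (use B.mult_closed S P in blast)+
  qed
  then have "cls (shift a b) \<in> idempotents (B_monoid C)"
    using fund cls_in_B[OF R] unfolding fundamental_def by blast
  then have id: "\<And>\<omega> z \<omega>' z'. moves (shift a b) \<omega> z \<omega>' z' \<Longrightarrow> z' = z"
    using cls_idempotent_iff[OF R] by blast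
  obtain \<omega> where w: "path \<omega>" "a \<in> \<omega>" by (rule path_through[OF sourceless ab(1)])
  have "path \<omega> \<and> \<omega> \<inter> dom (shift a b) \<noteq> {}"
    using w principal_self[OF ab(1)] by (auto simp: dom_shift)
  then obtain \<omega>' z' where m: "moves (shift a b) \<omega> (\<lambda>i. 0) \<omega>' z'" using moves_dom[OF R] by blast
  have "b \<in> \<omega>" "\<And>i. int (deg a $ i) = int (deg b $ i)" using mv[OF m] id[OF m] by auto
  then have "deg a = deg b" by (simp add: vec_eq_iff)
  then show False using path_unique[OF w(1,2) \<open>b \<in> \<omega>\<close>] ab(3) by blast
qed

end


section \<open>Additive ideals\<close>

context boolean_partial_bijection_rep
begin

text \<open>
  Because \<open>e = s\<inverse> s e\<close>.
\<close>

lemma ideal_contains_idempotent: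
  assumes I: "additive_ideal S I" and s: "s \<in> I" and e: "e \<in> idempotents S"
    and dom: "dom (\<phi> e) \<subseteq> dom (\<phi> s)"
  shows "e \<in> I"
proof -
  have sS: "s \<in> carrier S" and eS: "e \<in> carrier S" and id: "\<And>x y. \<phi> e x = Some y \<Longrightarrow> y = x"
    using I s e by (auto simp: additive_ideal_def idempotent_iff)
  have "sinv S s \<otimes> s \<otimes> e \<in> I"
    using I s eS sinv_closed[OF sS] unfolding additive_ideal_def by blast
  moreover have "sinv S s \<otimes> s \<otimes> e = e"
  proof (rule rep_eqI)
    fix x y
    have "\<phi> (sinv S s \<otimes> s \<otimes> e) x = Some y \<longleftrightarrow> (\<exists>u. \<phi> e x = Some u \<and> (\<exists>v. \<phi> s u = Some v \<and> \<phi> s y = Some v))"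
      unfolding mult_Some[OF mult_closed[OF sinv_closed[OF sS] sS] eS] mult_Some[OF sinv_closed[OF sS] sS]
        sinv_Some[OF sS] ..
    also have "\<dots> \<longleftrightarrow> \<phi> e x = Some y"
      using dom id rep_injective[OF sS] by blast
    finally show "\<phi> (sinv S s \<otimes> s \<otimes> e) x = Some y \<longleftrightarrow> \<phi> e x = Some y" .
  qed (use mult_closed sinv_closed sS eS in blast)+
  ultimately show ?thesis by simp
qed

text \<open>
  \<open>e t\<close> belongs to the ideal, and its domain contains that of \<open>f\<close>.
\<close>

lemma ideal_pullback:
  assumes I: "additive_ideal S I" and e: "e \<in> I" and t: "t \<in> carrier S" and f: "f \<in> idempotents S"
    and into: "\<And>x. x \<in> dom (\<phi> f) \<Longrightarrow> \<exists>y\<in>dom (\<phi> e). \<phi> t x = Some y"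
  shows "f \<in> I"
proof (rule ideal_contains_idempotent[OF I _ f])
  have eS: "e \<in> carrier S" using I e by (auto simp: additive_ideal_def)
  show "e \<otimes> t \<in> I" using I e t unfolding additive_ideal_def by blast
  show "dom (\<phi> f) \<subseteq> dom (\<phi> (e \<otimes> t))"
  proof
    fix x assume "x \<in> dom (\<phi> f)"
    then obtain y z where "\<phi> t x = Some y" "\<phi> e y = Some z" using into by blast
    then have "\<phi> (e \<otimes> t) x = Some z" unfolding mult_Some[OF eS t] by blast
    then show "x \<in> dom (\<phi> (e \<otimes> t))" by blast
  qed
qed

lemma ideal_finite_cover:
  assumes I: "additive_ideal S I" and "finite E" "E \<subseteq> I" "E \<subseteq> idempotents S"
  shows "\<exists>g\<in>I \<inter> idempotents S. dom (\<phi> g) = (\<Union>e\<in>E. dom (\<phi> e))"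
  using assms(2-4)
proof (induction E rule: finite_induct)
  case empty
  obtain s where "s \<in> I" using I by (auto simp: additive_ideal_def)
  then have "zero_of S \<in> I"
    by (rule ideal_contains_idempotent[OF I _ zero_idempotent(1)]) (simp add: zero_idempotent)
  then show ?case using zero_idempotent by auto
next
  case (insert e E)
  then obtain g where g: "g \<in> I" "g \<in> idempotents S" "dom (\<phi> g) = (\<Union>e\<in>E. dom (\<phi> e))" by auto
  have e: "e \<in> I" "e \<in> idempotents S" using insert.prems by auto
  have S: "e \<in> carrier S" "g \<in> carrier S" using e g by (auto simp: idempotent_iff)
  have comp: "compatible S e g" by (rule idempotents_compatible[OF e(2) g(2)])
  note j = join_rep[OF S comp]
  let ?j = "e \<squnion>\<^bsub>natural_order S\<^esub> g"
  have "?j \<in> I" using I e(1) g(1) comp unfolding additive_ideal_def by blast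
  moreover have "?j \<in> idempotents S" using j e(2) g(2) by (auto simp: idempotent_iff)
  moreover have "dom (\<phi> ?j) = (\<Union>e\<in>insert e E. dom (\<phi> e))"
  proof -
    have "dom (\<phi> ?j) = dom (\<phi> e) \<union> dom (\<phi> g)" using j(2) by (auto simp: dom_def)
    then show ?thesis using g(3) by simp
  qed
  ultimately show ?case by blast
qed

end

section \<open>Cofinality\<close>

context row_finite_graph
begin

text \<open>
  A non-zero element of the ideal is defined at some arrow \<open>a\<close>, so the ideal contains the projection of \<open>a C\<close>.
  By means of \<open>shift x (a \<bullet> g)\<close> it contains the projection of \<open>x C\<close> for every \<open>x\<close> that is connected to \<open>a\<close> by
  an arrow \<open>g\<close>.  Cofinality provides, for each of the finitely many identities \<open>f\<close>, finitely many such \<open>x\<close> that are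
  large in \<open>f C\<close>; altogether they cover all paths, so the ideal contains the unit.
\<close>

lemma cofinal_imp_zero_simplifying:
  assumes cof: "cofinal_category C"
  shows "zero_simplifying (B_monoid C)"
  unfolding zero_simplifying_def
proof (intro allI impI)
  fix I assume I: "additive_ideal (B_monoid C) I"
  show "I = {zero_of (B_monoid C)} \<or> I = carrier (B_monoid C)"
  proof (cases "I \<subseteq> {zero_of (B_monoid C)}")
    case True
    then show ?thesis using I by (auto simp: additive_ideal_def)
  next
    case False
    then obtain s where s: "s \<in> I" "s \<noteq> zero_of (B_monoid C)" by blast
    have sB: "s \<in> carrier (B_monoid C)" using I s by (auto simp: additive_ideal_def)
    then obtain \<theta> where \<theta>: "\<theta> \<in> \<R>" "s = cls \<theta>" by (rule B_carrierE)
    have "class_action s \<noteq> Map.empty" using s(2) B.eq_zero_iff[OF sB] by blast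
    then obtain x y where "class_action s x = Some y" by (metis ext not_None_eq)
    then have "class_action (cls \<theta>) (fst x, snd x) = Some (fst y, snd y)" using \<theta> by simp
    then obtain a b where ab: "\<theta> a = Some b"
      unfolding class_action_Some[OF \<theta>(1)] moves_def germ_def by blast
    have aC: "a \<in> arrows C" using R_D(1)[OF \<theta>(1) ab] .
    have P: "fin_gen (principal C a)" using fin_gen_principal[OF aC] .
    have "proj (principal C a) \<in> I"
    proof (rule B.ideal_contains_idempotent[OF I s(1) proj_idempotent[OF P]])
      show "dom (class_action (proj (principal C a))) \<subseteq> dom (class_action s)"
      proof
        fix p assume "p \<in> dom (class_action (proj (principal C a)))"
        then obtain \<omega> z x where p: "p = (\<omega>, z)" "path \<omega>" "x \<in> \<omega>" "x \<in> principal C a"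
          unfolding dom_proj[OF P] by blast
        then have "a \<in> \<omega>" using path_prefix aC by blast
        then obtain \<omega>' z' where "moves \<theta> \<omega> z \<omega>' z'" using moves_dom[OF \<theta>(1)] p(2) ab by blast
        then have "class_action s p = Some (\<omega>', z')" using class_action_Some \<theta> p by simp
        then show "p \<in> dom (class_action s)" by blast
      qed
    qed
    have reach: "proj (principal C x) \<in> I"
      if x: "x \<in> arrows C" and g: "g \<in> arrows C" "ccod C g = cdom C a" "cdom C g = cdom C x" for x g
    proof (rule B.ideal_pullback[OF I \<open>proj (principal C a) \<in> I\<close>])
      have ag: "composable a g" using aC g by simp
      have agC: "a \<bullet> g \<in> arrows C" "cdom C x = cdom C (a \<bullet> g)"
        using comp_closed[of a g] dom_comp[of a g] ag g by metis+
      have R: "shift x (a \<bullet> g) \<in> \<R>" by (rule shift_in_R[OF x agC])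
      show "cls (shift x (a \<bullet> g)) \<in> carrier (B_monoid C)" by (rule cls_in_B[OF R])
      have Px: "fin_gen (principal C x)" by (rule fin_gen_principal[OF x])
      show "proj (principal C x) \<in> idempotents (B_monoid C)" by (rule proj_idempotent[OF Px])
      fix p assume "p \<in> dom (class_action (proj (principal C x)))"
      then obtain \<omega> z y where p: "p = (\<omega>, z)" "path \<omega>" "y \<in> \<omega>" "y \<in> principal C x"
        unfolding dom_proj[OF Px] by blast
      then have "x \<in> \<omega>" using path_prefix x by blast
      moreover have "shift x (a \<bullet> g) x = Some (a \<bullet> g)"
        by (rule shift_base[OF x agC])
      ultimately obtain \<omega>' z' where g: "germ (shift x (a \<bullet> g)) x (a \<bullet> g) \<omega> z \<omega>' z'"
        using germ_ex[OF R _ p(2)] by blast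
      have "class_action (cls (shift x (a \<bullet> g))) p = Some (\<omega>', z')"
        unfolding p(1) class_action_Some[OF R] moves_def using g by blast
      moreover have "(\<omega>', z') \<in> dom (class_action (proj (principal C a)))"
        unfolding dom_proj[OF P] using germ_paths(2,4)[OF g] principalI[OF ag] by blast
      ultimately show "\<exists>y\<in>dom (class_action (proj (principal C a))). class_action (cls (shift x (a \<bullet> g))) p = Some y"
        by blast
    qed
    have "\<exists>X. finite X \<and> large_in C X f \<and> (\<forall>x\<in>X. proj (principal C x) \<in> I)" if f: "f \<in> idents C" for f
    proof -
      obtain X where X: "finite X" "large_in C X f"
        "\<forall>x\<in>X. \<exists>g\<in>arrows C. ccod C g = cdom C a \<and> cdom C g = cdom C x"
        using cof dom_ident[OF aC] f unfolding cofinal_category_def by blast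
      have "X \<subseteq> arrows C"
        using X(2) principal_arrows[OF ident_arrow[OF f]] unfolding large_in_def by blast
      then have "\<forall>x\<in>X. proj (principal C x) \<in> I" using X(3) reach by blast
      then show ?thesis using X by blast
    qed
    then obtain X where X: "\<And>f. f \<in> idents C \<Longrightarrow> finite (X f) \<and> large_in C (X f) f \<and> (\<forall>x\<in>X f. proj (principal C x) \<in> I)"
      using bchoice[of "idents C" "\<lambda>f X. finite X \<and> large_in C X f \<and> (\<forall>x\<in>X. proj (principal C x) \<in> I)"] by blast
    have XC: "x \<in> arrows C" if "f \<in> idents C" "x \<in> X f" for f x
      using X[OF that(1)] principal_arrows[OF ident_arrow[OF that(1)]] that(2) unfolding large_in_def by blast
    define E where "E = (\<Union>f\<in>idents C. (\<lambda>x. proj (principal C x)) ` X f)"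
    have "finite E" unfolding E_def by (intro finite_UN_I finite_imageI finite_idents) (use X in blast)
    moreover have "E \<subseteq> I" using X unfolding E_def by blast
    moreover have "E \<subseteq> idempotents (B_monoid C)"
    proof
      fix q assume "q \<in> E"
      then obtain f x where fx: "f \<in> idents C" "x \<in> X f" "q = proj (principal C x)"
        unfolding E_def by blast
      show "q \<in> idempotents (B_monoid C)"
        unfolding fx(3) by (rule proj_idempotent[OF fin_gen_principal[OF XC[OF fx(1,2)]]])
    qed
    ultimately have "\<exists>g\<in>I \<inter> idempotents (B_monoid C). dom (class_action g) = (\<Union>e\<in>E. dom (class_action e))"
      by (rule B.ideal_finite_cover[OF I])
    then obtain g where g: "g \<in> I" "dom (class_action g) = (\<Union>e\<in>E. dom (class_action e))"
      by (elim bexE IntE)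
    have "points \<subseteq> (\<Union>e\<in>E. dom (class_action e))"
    proof
      fix p assume "p \<in> points"
      then obtain \<omega> z where p: "p = (\<omega>, z)" "path \<omega>" by (auto simp: points_def)
      \<comment> \<open>any arrow of the path determines the identity \<open>f\<close> at which the path starts\<close>
      obtain a0 where a0: "a0 \<in> \<omega>" "deg a0 = 0" using path_ex[OF p(2)] by blast
      define f where "f = ccod C a0"
      have a0C: "a0 \<in> arrows C" by (rule path_arrow[OF p(2) a0(1)])
      have f: "f \<in> idents C" using cod_ident[OF a0C] f_def by simp
      have fw: "f \<in> \<omega>" using path_prefix[OF p(2) a0(1) principal_ident[OF a0C]] f ident_arrow f_def by blast
      have XfC: "X f \<subseteq> arrows C" using XC[OF f] by blast
      have "fin_gen (generated C (X f))" using fin_gen_generated XfC X[OF f] by blast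
      then obtain m where m: "\<And>a n x. a \<in> arrows C \<Longrightarrow> deg a = m + n \<Longrightarrow> x \<in> principal C a \<Longrightarrow>
          x \<in> generated C (X f) \<Longrightarrow> a \<in> generated C (X f)"
        by (rule fin_gen_degree_bound) blast
      obtain a where a: "a \<in> \<omega>" "deg a = m" using path_ex[OF p(2)] by blast
      have aC: "a \<in> arrows C" by (rule path_arrow[OF p(2) a(1)])
      \<comment> \<open>the degree bound turns dependence of \<open>a\<close> on an element of \<open>X f\<close> into membership of \<open>a\<close> in the ideal\<close>
      have "deg a = deg f + m" using a deg_ident[OF f] by simp
      then have "a \<in> principal C f" by (rule path_longer[OF p(2) fw a(1)])
      then obtain x where x: "x \<in> X f" "\<not> independent_arrows C a x"
        using X[OF f] unfolding large_in_def by blast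
      then obtain y where y: "y \<in> principal C a" "y \<in> principal C x" unfolding independent_arrows_def by blast
      have "y \<in> generated C (X f)" using x(1) y(2) generated_iff by blast
      then have "a \<in> generated C (X f)" using m[OF aC, of 0] a(2) y(1) by simp
      then obtain x' where x': "x' \<in> X f" "a \<in> principal C x'" using generated_iff by blast
      have "p \<in> dom (class_action (proj (principal C x')))"
        unfolding dom_proj[OF fin_gen_principal[OF XC[OF f x'(1)]]] using p a(1) x'(2) by blast
      then show "p \<in> (\<Union>e\<in>E. dom (class_action e))" using f x'(1) unfolding E_def by blast
    qed
    then have "\<one>\<^bsub>B_monoid C\<^esub> \<in> I"
      by (intro B.ideal_contains_idempotent[OF I g(1)]) (simp_all add: B.one_idempotent g(2))
    then have "t \<in> I" if "t \<in> carrier (B_monoid C)" for t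
      using I that monoid.l_one[OF B.monoid_S that] unfolding additive_ideal_def by metis
    then show ?thesis using I unfolding additive_ideal_def by blast
  qed
qed

text \<open>
  Let \<open>J\<close> be the set of arrows \<open>x\<close> such that some arrow leads from \<open>cdom C x\<close> to \<open>e\<close>.  Morphisms preserve
  \<open>cdom\<close>, so \<open>J\<close> is invariant under \<open>R(C)\<close>, and the classes of the elements with domain inside \<open>J\<close> form a non-zero
  additive ideal.  If it is everything, the projection of \<open>f C\<close> is represented by some \<open>\<theta>\<close> with
  \<open>dom \<theta> \<subseteq> J\<close>, and generators of \<open>dom \<theta> \<inter> f C\<close> form the required large set.
\<close>

lemma zero_simplifying_imp_cofinal:
  assumes zs: "zero_simplifying (B_monoid C)"
  shows "cofinal_category C"
  unfolding cofinal_category_def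
proof (intro ballI)
  fix e f assume e: "e \<in> idents C" and f: "f \<in> idents C"
  have eC: "e \<in> arrows C" and fC: "f \<in> arrows C" using e f ident_arrow by auto
  define J where "J = {x \<in> arrows C. \<exists>g\<in>arrows C. ccod C g = e \<and> cdom C g = cdom C x}"
  define I where "I = {cls \<theta> | \<theta>. \<theta> \<in> \<R> \<and> dom \<theta> \<subseteq> J}"
  have Pe: "fin_gen (principal C e)" and Pf: "fin_gen (principal C f)"
    using fin_gen_principal eC fC by auto
  have "principal C e \<subseteq> J" using principal_ident_iff[OF e] by (auto simp: J_def)
  then have peI: "proj (principal C e) \<in> I"
    unfolding I_def proj_def
    by (intro CollectI exI[of _ "Some |` principal C e"] conjI refl identity_in_R[OF Pe])
      (simp only: dom_restrict_Some)
  have "additive_ideal (B_monoid C) I"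
    unfolding additive_ideal_def
  proof (intro conjI ballI impI)
    show "I \<subseteq> carrier (B_monoid C)" using cls_in_B by (auto simp: I_def)
    show "I \<noteq> {}" using peI by blast
    fix s assume "s \<in> I"
    then obtain \<theta> where \<theta>: "\<theta> \<in> \<R>" "s = cls \<theta>" "dom \<theta> \<subseteq> J" by (auto simp: I_def)
    {
      fix t assume "t \<in> carrier (B_monoid C)"
      then obtain \<eta> where \<eta>: "\<eta> \<in> \<R>" "t = cls \<eta>" by (rule B_carrierE)
      have "dom (\<theta> \<circ>\<^sub>m \<eta>) \<subseteq> J"
      proof
        fix x assume "x \<in> dom (\<theta> \<circ>\<^sub>m \<eta>)"
        then obtain y w where y: "\<eta> x = Some y" "\<theta> y = Some w"
          by (auto simp: map_comp_Some_iff)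
        then have "y \<in> J" using \<theta>(3) by blast
        then show "x \<in> J" using R_D(1,3)[OF \<eta>(1) y(1)] by (simp add: J_def)
      qed
      then show "s \<otimes>\<^bsub>B_monoid C\<^esub> t \<in> I"
        using B_mult[OF \<theta>(1) \<eta>(1)] R_mult_closed[OF \<theta>(1) \<eta>(1)] \<theta>(2) \<eta>(2) unfolding I_def by blast
      have "dom (\<eta> \<circ>\<^sub>m \<theta>) \<subseteq> J"
      proof
        fix x assume "x \<in> dom (\<eta> \<circ>\<^sub>m \<theta>)"
        then obtain y w where "\<theta> x = Some y" "\<eta> y = Some w" by (auto simp: map_comp_Some_iff)
        then show "x \<in> J" using \<theta>(3) by blast
      qed
      then show "t \<otimes>\<^bsub>B_monoid C\<^esub> s \<in> I"
        using B_mult[OF \<eta>(1) \<theta>(1)] R_mult_closed[OF \<eta>(1) \<theta>(1)] \<theta>(2) \<eta>(2) unfolding I_def by blast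
    }
    fix t assume "t \<in> I" and comp: "compatible (B_monoid C) s t"
    then obtain \<eta> where \<eta>: "\<eta> \<in> \<R>" "t = cls \<eta>" "dom \<eta> \<subseteq> J" by (auto simp: I_def)
    have S: "s \<in> carrier (B_monoid C)" "t \<in> carrier (B_monoid C)" using \<theta> \<eta> cls_in_B by auto
    note c = comp[unfolded B.compatible_iff[OF S]]
    have u: "\<theta> ++ \<eta> \<in> \<R> \<and> (\<forall>x y. class_action (cls (\<theta> ++ \<eta>)) x = Some y \<longleftrightarrow>
        class_action s x = Some y \<or> class_action t x = Some y)"
      unfolding \<theta>(2) \<eta>(2)
      by (rule class_union[OF \<theta>(1) \<eta>(1)]) (use c[unfolded \<theta>(2) \<eta>(2)] in blast)+
    have "s \<squnion>\<^bsub>natural_order (B_monoid C)\<^esub> t = cls (\<theta> ++ \<eta>)"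
    proof (rule B.rep_eqI)
      show "s \<squnion>\<^bsub>natural_order (B_monoid C)\<^esub> t \<in> carrier (B_monoid C)" by (rule B.join_rep[OF S comp])
      show "cls (\<theta> ++ \<eta>) \<in> carrier (B_monoid C)" using u cls_in_B by blast
    qed (simp add: B.join_rep(2)[OF S comp] u)
    moreover have "dom (\<theta> ++ \<eta>) \<subseteq> J" using \<theta>(3) \<eta>(3) by simp
    ultimately show "s \<squnion>\<^bsub>natural_order (B_monoid C)\<^esub> t \<in> I" using u unfolding I_def by blast
  qed
  moreover have "proj (principal C e) \<noteq> zero_of (B_monoid C)"
  proof
    assume "proj (principal C e) = zero_of (B_monoid C)"
    then have "dom (class_action (proj (principal C e))) = {}" by (simp add: B.rep_zero)
    moreover obtain \<omega> where "path \<omega>" "e \<in> \<omega>" by (rule path_through[OF sourceless eC])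
    ultimately show False using principal_self[OF eC] unfolding dom_proj[OF Pe] by blast
  qed
  ultimately have "I = carrier (B_monoid C)" using zs peI unfolding zero_simplifying_def by blast
  then have "proj (principal C f) \<in> I" using proj_in_B[OF Pf] by simp
  then obtain \<theta> where \<theta>: "\<theta> \<in> \<R>" "proj (principal C f) = cls \<theta>" "dom \<theta> \<subseteq> J" by (auto simp: I_def)
  obtain X where X: "X \<subseteq> arrows C" "finite X" "dom \<theta> \<inter> principal C f = generated C X"
    using fin_gen_Int[OF aligned R_dom[OF \<theta>(1)] Pf] unfolding fin_gen_def by blast
  have XJ: "X \<subseteq> J" "X \<subseteq> principal C f" using generated_superset[OF X(1)] X(3) \<theta>(3) by auto
  have "large_in C X f"
    unfolding large_in_def
  proof (intro conjI ballI)
    fix b assume b: "b \<in> principal C f"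
    have bC: "b \<in> arrows C" using principal_arrows[OF fC] b by blast
    obtain \<omega> where w: "path \<omega>" "b \<in> \<omega>" by (rule path_through[OF sourceless bC])
    have "moves (Some |` principal C f) \<omega> (\<lambda>i. 0) \<omega> (\<lambda>i. 0)"
      unfolding moves_identity using w b by blast
    then have "moves \<theta> \<omega> (\<lambda>i. 0) \<omega> (\<lambda>i. 0)"
      using \<theta>(2) class_action_Some[OF \<theta>(1)] class_action_Some[OF identity_in_R[OF Pf]] unfolding proj_def by metis
    then obtain d where d: "d \<in> \<omega>" "d \<in> dom \<theta>" using moves_dom[OF \<theta>(1)] by blast
    obtain c c' where c: "composable b c" "composable d c'" "b \<bullet> c = d \<bullet> c'"
      by (rule path_directed[OF w d(1)])
    have "b \<bullet> c \<in> dom \<theta>" using fin_gen_right_closed[OF R_dom[OF \<theta>(1)] d(2) c(2)] c(3) by simp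
    moreover have "b \<bullet> c \<in> principal C f" by (rule principal_trans[OF principalI[OF c(1)] b fC])
    ultimately obtain x where "x \<in> X" "b \<bullet> c \<in> principal C x" using X(3) generated_iff by blast
    then show "\<exists>x\<in>X. \<not> independent_arrows C b x"
      using principalI[OF c(1)] unfolding independent_arrows_def by blast
  qed (use XJ in blast)
  then show "\<exists>X. finite X \<and> large_in C X f \<and> (\<forall>x\<in>X. \<exists>a\<in>arrows C. ccod C a = e \<and> cdom C a = cdom C x)"
    using X(2) XJ(1) unfolding J_def by blast
qed

end

section \<open>Simplicity\<close>

theorem theorem7p13:
  fixes C :: "'a category" and deg :: "'a \<Rightarrow> nat ^ 'k"
  assumes "higher_rank_graph C deg"
    and "finitely_aligned C"
    and "finite (idents C)"
    and "no_sources C deg"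
    and "row_finite C deg"
  shows "boolean_inverse_monoid (B_monoid C) \<and>
    (aperiodic_category C \<and> cofinal_category C \<longleftrightarrow> simple (B_monoid C))"
proof -
  interpret row_finite_graph C deg
    using assms by (simp add: row_finite_graph_def row_finite_graph_axioms_def)
  show ?thesis
    unfolding simple_def
    using B.boolean_inverse_monoid_S aperiodic_imp_fundamental fundamental_imp_aperiodic
      cofinal_imp_zero_simplifying zero_simplifying_imp_cofinal by blast
qed

end
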